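(* Let $c:[\frac12,1]\to[0,+\infty)$, and consider for $p\in[0,1]$ $$L(p):=\sup_{a\in[\frac12,1]} c(a)\max\big\{p-p^{\frac1a},\ 1-p-(1-p)^{\frac1a}\big\}.$$ If $(X,d,\mu)$ is a metric probability space satisfying Hypothesis $(\mathcal H)$ and $I_\mu\ge L$ on $[0,1]$, then $I_{\mu^\infty}\ge L$ on $[0,1]$. Moreover there exists an even probability measure $\nu$ on $\mathbb R$ such that $I_\nu=I_{\nu^\infty}=L$ and such that for all $n\ge 1$, coordinate half-spaces are solutions to the isoperimetric problem for $\nu^n$.
   Context: A metric probability space $(X,d,\mu)$ is a separable metric space $(X,d)$ with a Borel probability measure $\mu$. For a Borel set $A\subseteq X$ and $r>0$, let $A_r=\{x\in X : d(x,A)<r\}$, and define the outer and inner boundary measures $\mu^+(A)=\liminf_{r\to0^+}\frac{\mu(A_r)-\mu(A)}{r}$, $\mu^-(A)=\mu^+(X\setminus A)$. The isoperimetric function is, for $p\in[0,1]$, $I_\mu(p)=I_{(X,d,\mu)}(p)=\inf\{\min(\mu^+(A),\mu^-(A)) : A\subseteq X \text{ Borel},\ \mu(A)=p\}$ (infimum over the empty set being $+\infty$). For $n\ge1$, $X^n$ carries the product measure $\mu^n=\mu^{\otimes n}$ and the supremum distance $d_\infty^{(n)}(x,y)=\max_i d(x_i,y_i)$. The infinite dimensional isoperimetric profile is $I_{\mu^\infty}(t)=\inf_{n\ge1} I_{(X^n,d_\infty^{(n)},\mu^n)}(t)$, $t\in[0,1]$. Measures on $\mathbb R$ are considered with the usual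 distance. For a locally Lipschitz function $f:Y\to\mathbb R$ on a metric space $(Y,\rho)$, the modulus of gradient is $|\nabla f|(x)=\limsup_{\rho(x,y)\to0^+}\frac{|f(x)-f(y)|}{\rho(x,y)}$ (equal to $0$ at isolated points). Hypothesis $(\mathcal H)$ for $(X,d,\mu)$: for every $m,n\ge 1$ and every locally Lipschitz $f:X^{m+n}\to\mathbb R$ (products carrying the supremum distances), for $\mu^{m+n}$-almost every $(x,y)\in X^m\times X^n$, $|\nabla f|(x,y)=|\nabla_x f|(x,y)+|\nabla_y f|(x,y)$, where $|\nabla_x f|(x,y)$ is the modulus of gradient of $f(\cdot,y)$ at $x$ and $|\nabla_y f|(x,y)$ that of $f(x,\cdot)$ at $y$. A coordinate half-space of $\mathbb R^n$ is a set of the form $\{x\in\mathbb R^n : x_1\le t\}$. That coordinate half-spaces are solutions to the isoperimetric problem for $\nu^n$ means that for every $p\in(0,1)$ the infimum defining $I_{(\mathbb R^n,d_\infty^{(n)},\nu^n)}(p)$ is attained at a coordinate half-space of $\nu^n$-measure $p$.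
   Formalization: The claim that coordinate half-spaces solve the isoperimetric problem for ν^n is made only when 0 < L < ∞ on (0,1); in the only other cases, L = 0 (e.g. c = 0) or L = ∞ on all of (0,1), no measure with I_ν = L has this property. *)

theory Defs
  imports "HOL-Probability.Probability"
begin

definition borel_sets_of :: "'a metric \<Rightarrow> 'a set set" where
  "borel_sets_of X = sigma_sets (mspace X) {U. openin (mtopology_of X) U}"

definition metric_prob_space :: "'a metric \<Rightarrow> 'a measure \<Rightarrow> bool" where
  "metric_prob_space X \<mu> \<longleftrightarrow>
     prob_space \<mu> \<and> space \<mu> = mspace X \<and> sets \<mu> = borel_sets_of X \<and>
     separable_space (mtopology_of X)"

text \<open>The distance of a point to a set is an infimum in the extended reals, so the distance
  to the empty set is infinite and the enlargement of the empty set is empty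
  (\<^const>\<open>infdist\<close> would give distance zero instead).\<close>

definition enlargement :: "'a metric \<Rightarrow> 'a set \<Rightarrow> real \<Rightarrow> 'a set" where
  "enlargement X A r = {x \<in> mspace X. (INF y\<in>A. ereal (mdist X x y)) < ereal r}"

definition outer_boundary :: "'a metric \<Rightarrow> 'a measure \<Rightarrow> 'a set \<Rightarrow> ennreal" where
  "outer_boundary X \<mu> A =
     Liminf (at_right 0) (\<lambda>r. ennreal ((measure \<mu> (enlargement X A r) - measure \<mu> A) / r))"

definition inner_boundary :: "'a metric \<Rightarrow> 'a measure \<Rightarrow> 'a set \<Rightarrow> ennreal" where
  "inner_boundary X \<mu> A = outer_boundary X \<mu> (mspace X - A)"

definition isoperimetric :: "'a metric \<Rightarrow> 'a measure \<Rightarrow> real \<Rightarrow> ennreal" where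
  "isoperimetric X \<mu> p =
     (INF A\<in>{A \<in> borel_sets_of X. measure \<mu> A = p}.
        min (outer_boundary X \<mu> A) (inner_boundary X \<mu> A))"

text \<open>Finite powers are indexed by a finite set of naturals: the metric is
  \<^term>\<open>funspace I X\<close> (functions on the index set with the supremum distance), the measure
  \<^term>\<open>Pi\<^sub>M I (\<lambda>_. \<mu>)\<close>.  The next lemmas say that for finite nonempty index sets this
  is the power of the set of points, with the maximum of the coordinate distances, and that
  the power of a metric probability space is a metric probability space: its measurable sets
  are the Borel sets of the supremum distance.\<close>

lemma mspace_funspace_finite:
  assumes "finite I"
  shows "mspace (funspace I X) = (\<Pi>\<^sub>E i\<in>I. mspace X)"
proof -
  interpret Metric_space "mspace X" "mdist X" by (rule Metric_space_mspace_mdist)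
  have "mbounded S" if "finite S" "S \<subseteq> mspace X" for S
    using that by (induction S rule: finite_induct) (auto simp: mbounded_insert)
  then show ?thesis
    using assms by (auto simp: fspace_def PiE_def Pi_def image_subset_iff)
qed

lemma mdist_funspace_finite:
  assumes "finite I" "I \<noteq> {}" "x \<in> (\<Pi>\<^sub>E i\<in>I. mspace X)" "y \<in> (\<Pi>\<^sub>E i\<in>I. mspace X)"
  shows "mdist (funspace I X) x y = Max ((\<lambda>i. mdist X (x i) (y i)) ` I)"
proof -
  interpret Metric_space "mspace X" "mdist X" by (rule Metric_space_mspace_mdist)
  have "x \<in> fspace I" "y \<in> fspace I"
    using assms mspace_funspace_finite[of I X] by auto
  then show ?thesis
    using assms by (simp add: fdist_def cSup_eq_Max)
qed

lemma openin_mtopology_of_iff: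
  "openin (mtopology_of X) U \<longleftrightarrow>
     U \<subseteq> mspace X \<and> (\<forall>x\<in>U. \<exists>r>0. \<forall>y\<in>mspace X. mdist X x y < r \<longrightarrow> y \<in> U)"
proof -
  interpret Metric_space "mspace X" "mdist X" by (rule Metric_space_mspace_mdist)
  show ?thesis
    unfolding mtopology_of_def openin_mtopology by (simp add: subset_iff) blast
qed

lemma separable_mtopology_of_iff:
  "separable_space (mtopology_of X) \<longleftrightarrow>
     (\<exists>C. countable C \<and> C \<subseteq> mspace X \<and> (\<forall>x\<in>mspace X. \<forall>r>0. \<exists>y\<in>C. mdist X x y < r))"
proof -
  interpret Metric_space "mspace X" "mdist X" by (rule Metric_space_mspace_mdist)
  have "mtopology closure_of C = mspace X \<longleftrightarrow> (\<forall>x\<in>mspace X. \<forall>r>0. \<exists>y\<in>C. mdist X x y < r)"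
    if "C \<subseteq> mspace X" for C
  proof -
    have "mtopology closure_of C = {x \<in> mspace X. \<forall>r>0. \<exists>y\<in>C. mdist X x y < r}"
      unfolding metric_closure_of using that by (intro Collect_cong) (auto simp: subset_iff in_mball)
    then show ?thesis by blast
  qed
  then show ?thesis
    unfolding separable_space_def mtopology_of_def by (simp cong: conj_cong)
qed

lemma metric_prob_space_power:
  assumes X: "metric_prob_space X \<mu>" and I: "finite I" "I \<noteq> {}"
  shows "metric_prob_space (funspace I X) (Pi\<^sub>M I (\<lambda>_. \<mu>))"
proof -
  have P: "prob_space \<mu>" and sp: "space \<mu> = mspace X" and st: "sets \<mu> = borel_sets_of X"
    using X by (auto simp: metric_prob_space_def)
  interpret Metric_space "mspace X" "mdist X" by (rule Metric_space_mspace_mdist)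
  let ?Y = "funspace I X" and ?E = "\<Pi>\<^sub>E i\<in>I. mspace X"
  let ?P = "Pi\<^sub>M I (\<lambda>_. \<mu>)"
  have Y: "mspace ?Y = ?E" by (rule mspace_funspace_finite[OF I(1)])
  have spP: "space ?P = mspace ?Y" by (simp add: space_PiM sp Y del: mspace_funspace)
  have less: "mdist ?Y x y < r \<longleftrightarrow> (\<forall>i\<in>I. mdist X (x i) (y i) < r)"
    if "x \<in> ?E" "y \<in> ?E" for x y r
    using that I by (simp add: mdist_funspace_finite del: mdist_funspace)
  obtain C where C: "countable C" "C \<subseteq> mspace X"
    and dense: "\<And>x r. x \<in> mspace X \<Longrightarrow> r > 0 \<Longrightarrow> \<exists>y\<in>C. mdist X x y < r"
    using X unfolding metric_prob_space_def separable_mtopology_of_iff by blast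
  define D where "D = (\<Pi>\<^sub>E i\<in>I. C)"
  have D: "countable D" "D \<subseteq> ?E"
    using I C by (auto simp: D_def intro!: countable_PiE)
  have denseD: "\<exists>y\<in>D. mdist ?Y x y < r" if "x \<in> ?E" "r > 0" for x r
  proof -
    have "\<forall>i\<in>I. \<exists>y\<in>C. mdist X (x i) y < r" using that dense by auto
    then obtain g where "\<forall>i\<in>I. g i \<in> C \<and> mdist X (x i) (g i) < r" by metis
    then have "restrict g I \<in> D" "\<forall>i\<in>I. mdist X (x i) (restrict g I i) < r"
      by (auto simp: D_def)
    moreover from this have "mdist ?Y x (restrict g I) < r"
      using less[OF that(1), of "restrict g I" r] D(2) by (simp only: subset_iff)
    ultimately show ?thesis by (intro bexI)
  qed
  have sep: "separable_space (mtopology_of ?Y)"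
    unfolding separable_mtopology_of_iff Y using D denseD by (intro exI[of _ D] conjI ballI allI impI)
  let ?O = "{U. openin (mtopology_of ?Y) U}"
  have OP: "?O \<subseteq> Pow (mspace ?Y)" unfolding openin_mtopology_of_iff by blast
  define N where "N = sigma (mspace ?Y) ?O"
  have N: "space N = mspace ?Y" "sets N = borel_sets_of ?Y"
    unfolding N_def borel_sets_of_def by (rule space_measure_of[OF OP], rule sets_measure_of[OF OP])
  have "(\<lambda>x i. x i) \<in> measurable N ?P"
  proof (rule measurable_PiM_single')
    fix i assume i: "i \<in> I"
    show "(\<lambda>x. x i) \<in> measurable N \<mu>"
    proof (rule measurable_sigma_sets[where \<Omega> = "mspace X" and A = "{U. openin (mtopology_of X) U}"])
      show "sets \<mu> = sigma_sets (mspace X) {U. openin (mtopology_of X) U}"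
        by (simp add: st borel_sets_of_def)
      show "{U. openin (mtopology_of X) U} \<subseteq> Pow (mspace X)"
        by (auto simp: openin_mtopology_of_iff)
      show "(\<lambda>x. x i) \<in> space N \<rightarrow> mspace X"
        using i unfolding N Y by auto
      fix U assume U: "U \<in> {U. openin (mtopology_of X) U}"
      have "openin (mtopology_of ?Y) ((\<lambda>x. x i) -` U \<inter> space N)"
        unfolding openin_mtopology_of_iff N Y
      proof (intro conjI ballI)
        fix x assume x: "x \<in> (\<lambda>x. x i) -` U \<inter> ?E"
        then obtain r where r: "r > 0" "\<forall>y\<in>mspace X. mdist X (x i) y < r \<longrightarrow> y \<in> U"
          using U by (auto simp: openin_mtopology_of_iff)
        have "y \<in> (\<lambda>x. x i) -` U \<inter> ?E" if "y \<in> ?E" "mdist ?Y x y < r" for y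
        proof -
          have "mdist X (x i) (y i) < r" using less[of x y r] x that i by blast
          moreover have "y i \<in> mspace X" using that i by auto
          ultimately show ?thesis using r that by auto
        qed
        with r(1) show "\<exists>r>0. \<forall>y\<in>?E. mdist ?Y x y < r \<longrightarrow> y \<in> (\<lambda>x. x i) -` U \<inter> ?E" by blast
      qed auto
      then show "(\<lambda>x. x i) -` U \<inter> space N \<in> sets N"
        by (simp add: N borel_sets_of_def del: mspace_funspace)
    qed
  next
    show "(\<lambda>x i. x i) \<in> space N \<rightarrow> (\<Pi>\<^sub>E i\<in>I. space \<mu>)"
      unfolding N Y sp by auto
  qed
  then have "(\<lambda>x. x) -` A \<inter> space N \<in> sets N" if "A \<in> sets ?P" for A
    using that by (rule measurable_sets)
  then have 1: "sets ?P \<subseteq> borel_sets_of ?Y"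
    using sets.sets_into_space[of _ ?P] unfolding N spP by (metis Int_absorb2 subsetI vimage_ident)
  have ball: "{y\<in>?E. mdist ?Y x y < r} \<in> sets ?P" if x: "x \<in> ?E" for x r
  proof -
    have "{y\<in>?E. mdist ?Y x y < r} = (\<Pi>\<^sub>E i\<in>I. {z\<in>mspace X. mdist X (x i) z < r})" (is "?A = ?B")
    proof (rule set_eqI)
      fix y
      have "y \<in> ?A \<longleftrightarrow> y \<in> ?E \<and> (\<forall>i\<in>I. mdist X (x i) (y i) < r)"
        using less[OF x] by blast
      also have "\<dots> \<longleftrightarrow> y \<in> ?B" by (auto simp: PiE_iff)
      finally show "y \<in> ?A \<longleftrightarrow> y \<in> ?B" .
    qed
    moreover have "{z\<in>mspace X. mdist X (x i) z < r} \<in> sets \<mu>" if "i \<in> I" for i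
    proof -
      have "{z\<in>mspace X. mdist X (x i) z < r} = mball (x i) r"
        using x that by (auto simp: in_mball)
      then show ?thesis
        unfolding st borel_sets_of_def mtopology_of_def
        by (auto intro: sigma_sets.Basic)
    qed
    ultimately show ?thesis
      using sets_PiM_I_finite[OF I(1), of "\<lambda>i. {z\<in>mspace X. mdist X (x i) z < r}" "\<lambda>_. \<mu>"]
      by simp
  qed
  have "U \<in> sets ?P" if U: "openin (mtopology_of ?Y) U" for U
  proof -
    let ?B = "\<lambda>(x, q::rat). {y\<in>?E. mdist ?Y x y < of_rat q}"
    let ?S = "{(x, q). x \<in> D \<and> ?B (x, q) \<subseteq> U}"
    have UE: "U \<subseteq> ?E" using U unfolding openin_mtopology_of_iff Y by blast
    have U_eq: "U = (\<Union>s\<in>?S. ?B s)"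
    proof
      show "U \<subseteq> (\<Union>s\<in>?S. ?B s)"
      proof
        fix x assume x: "x \<in> U"
        then have xE: "x \<in> ?E" using UE by blast
        obtain r where r: "r > 0" "\<forall>y\<in>?E. mdist ?Y x y < r \<longrightarrow> y \<in> U"
          using U x unfolding openin_mtopology_of_iff Y by blast
        obtain q :: rat where q: "0 < real_of_rat q" "real_of_rat q < r/2"
          using of_rat_dense[of 0 "r/2"] r(1) by auto
        obtain d where d: "d \<in> D" "mdist ?Y x d < of_rat q"
          using denseD[OF xE q(1)] by blast
        have dE: "d \<in> ?E" using d D by blast
        have sym: "mdist ?Y d x = mdist ?Y x d"
          by (rule mdist_commute)
        have "y \<in> U" if y: "y \<in> ?E" "mdist ?Y d y < of_rat q" for y
        proof -
          have "mdist ?Y x y \<le> mdist ?Y x d + mdist ?Y d y"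
            by (rule mdist_triangle) (use xE dE y in \<open>simp_all add: Y del: mspace_funspace\<close>)
          then show ?thesis using r y d q by force
        qed
        then have "(d, q) \<in> ?S" using d by auto
        moreover have "x \<in> ?B (d, q)" using d xE sym by auto
        ultimately show "x \<in> (\<Union>s\<in>?S. ?B s)" by blast
      qed
    qed auto
    have cnt: "countable ?S"
      by (rule countable_subset[of _ "D \<times> UNIV"]) (use D in auto)
    have mem: "?B s \<in> sets ?P" if "s \<in> ?S" for s
      using that ball D by (auto simp del: mdist_funspace)
    show ?thesis
      by (subst U_eq) (rule sets.countable_UN'[OF cnt image_subsetI[OF mem]])
  qed
  then have "sigma_sets (space ?P) ?O \<subseteq> sets ?P"
    by (intro sets.sigma_sets_subset) auto
  then have 2: "borel_sets_of ?Y \<subseteq> sets ?P"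
    unfolding borel_sets_of_def spP .
  show ?thesis
    unfolding metric_prob_space_def
    using 1 2 sep spP prob_space_PiM[of I "\<lambda>_. \<mu>"] P by blast
qed

definition profile_inf :: "'a metric \<Rightarrow> 'a measure \<Rightarrow> real \<Rightarrow> ennreal" where
  "profile_inf X \<mu> t =
     (INF n\<in>{1::nat..}. isoperimetric (funspace {..<n} X) (Pi\<^sub>M {..<n} (\<lambda>_. \<mu>)) t)"

definition locally_Lipschitz :: "'a metric \<Rightarrow> ('a \<Rightarrow> real) \<Rightarrow> bool" where
  "locally_Lipschitz Y f \<longleftrightarrow>
     (\<forall>x\<in>mspace Y. \<exists>e>0.
        Lipschitz_continuous_map (submetric Y (mball_of Y x e)) euclidean_metric f)"

text \<open>At an isolated point the filter is trivial, and the upper limit in \<^typ>\<open>ennreal\<close> is 0.\<close>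

definition mod_grad :: "'a metric \<Rightarrow> ('a \<Rightarrow> real) \<Rightarrow> 'a \<Rightarrow> ennreal" where
  "mod_grad Y f x =
     Limsup (atin (mtopology_of Y) x) (\<lambda>y. ennreal (\<bar>f x - f y\<bar> / mdist Y x y))"

text \<open>A point of the power indexed by \<open>{..<m + n}\<close> is split into its restrictions to the first
  \<open>m\<close> and the last \<open>n\<close> coordinates; the latter block keeps its index set \<open>{m..<m + n}\<close>.\<close>

definition hypothesis_H :: "'a metric \<Rightarrow> 'a measure \<Rightarrow> bool" where
  "hypothesis_H X \<mu> \<longleftrightarrow>
     (\<forall>m\<ge>1. \<forall>n\<ge>1. \<forall>f :: (nat \<Rightarrow> 'a) \<Rightarrow> real. locally_Lipschitz (funspace {..<m + n} X) f \<longrightarrow>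
       (AE z in Pi\<^sub>M {..<m + n} (\<lambda>_. \<mu>).
          mod_grad (funspace {..<m + n} X) f z =
            mod_grad (funspace {..<m} X)
              (\<lambda>x. f (merge {..<m} {m..<m + n} (x, restrict z {m..<m + n}))) (restrict z {..<m}) +
            mod_grad (funspace {m..<m + n} X)
              (\<lambda>y. f (merge {..<m} {m..<m + n} (restrict z {..<m}, y))) (restrict z {m..<m + n})))"

text \<open>The term for each \<open>a\<close> is nonnegative when \<open>c a \<ge> 0\<close> and \<open>0 \<le> p \<le> 1\<close>, so \<^const>\<open>ennreal\<close> does
  not truncate.  The supremum may be infinite.\<close>

definition L_fun :: "(real \<Rightarrow> real) \<Rightarrow> real \<Rightarrow> ennreal" where
  "L_fun c p =
     (SUP a\<in>{1/2..1}. ennreal (c a * max (p - p powr (1/a)) (1 - p - (1 - p) powr (1/a))))"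

definition coord_halfspace :: "nat \<Rightarrow> real \<Rightarrow> (nat \<Rightarrow> real) set" where
  "coord_halfspace n t = {x \<in> (\<Pi>\<^sub>E i\<in>{..<n}. UNIV). x 0 \<le> t}"

definition halfspaces_solve :: "nat \<Rightarrow> real measure \<Rightarrow> bool" where
  "halfspaces_solve n \<nu> \<longleftrightarrow>
     (let X = funspace {..<n} euclidean_metric; P = Pi\<^sub>M {..<n} (\<lambda>_. \<nu>) in
      \<forall>p\<in>{0<..<1}. \<exists>t. measure P (coord_halfspace n t) = p \<and>
        min (outer_boundary X P (coord_halfspace n t)) (inner_boundary X P (coord_halfspace n t))
          = isoperimetric X P p)"

definition even_measure :: "real measure \<Rightarrow> bool" where
  "even_measure \<nu> \<longleftrightarrow> distr \<nu> borel uminus = \<nu>"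

end

theory Submission
  imports Defs
begin

text \<open>For \<open>s = 1/a\<close> in \<open>{1..2}\<close> put \<open>J = c(a) * max (p - p\<^sup>s) (1 - p - (1 - p)\<^sup>s)\<close>, so that \<open>L\<close> is the
  supremum of these functions \<open>J\<close>.  A lower bound by \<open>L\<close> is a lower bound by every \<open>J\<close>, and
  each \<open>J\<close> is treated separately.

  \<^bold>\<open>Products.\<close>  Replace the infinitesimal enlargement by a finite one: the outer boundary measure of
  every Borel set \<open>A\<close> is at least \<open>J (\<mu> A)\<close> if and only if all open sets satisfy
  \<open>\<mu>(U\<^sub>r) \<ge> \<mu>(U) + r J(\<mu> U) - K r\<^sup>2\<close> for some constant \<open>K\<close>
  (\<open>open_growth_of_boundary\<close>, \<open>boundary_of_open_growth\<close>).  For the supremum distance the enlargement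
  of a subset of a product is obtained by enlarging one coordinate after the other.  So the growth of a
  subset \<open>A\<close> of a product with two factors is bounded below, up to \<open>O(r\<^sup>2)\<close>, by \<open>r\<close> times the sum of
  the mean of \<open>J\<close> over the measures \<open>p\<^sub>y\<close> of the sections in one direction and its mean over the
  measures \<open>q\<^sub>x\<close> of those in the other
  (\<open>two_step_growth\<close>).  That sum is at least \<open>J\<close> of the measure \<open>P\<close> of \<open>A\<close>
  (\<open>section_model_profile_inequality\<close>): with \<open>b = s - 1\<close>, the power terms are bounded by integrating
  \<open>p\<^sub>y\<^sup>b + q\<^sub>x\<^sup>b \<le> 1 + (p\<^sub>y q\<^sub>x)\<^sup>b\<close> over \<open>A\<close>, because \<open>t\<^sup>b\<close> is concave and the integral of
  \<open>p\<^sub>y q\<^sub>x\<close> over \<open>A\<close> is at most \<open>P\<^sup>2\<close>, its integral over the whole product.  Induction on the number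
  of factors gives the growth in every power.

  \<^bold>\<open>The measure on the line.\<close>  Besides \<open>L(1 - p) = L(p)\<close> only the scaling property
  \<open>t L(p) \<le> L(t p)\<close> for \<open>t\<close> in \<open>{0..1}\<close> is used, which comes from concavity.  It shows that on
  \<open>{0<..<1}\<close> the function \<open>L\<close> is identically zero, identically infinite, or positive and finite, and
  in the last case that it is continuous and subadditive.  In that case choose \<open>G\<close> with derivative
  \<open>1/L\<close> and \<open>G(1 - p) = - G(p)\<close>, and let \<open>\<nu>\<close> be the law of \<open>G\<close> under the uniform distribution on
  \<open>{0<..<1}\<close>.  The half-line of measure \<open>p\<close> ends at \<open>G(p)\<close>, where \<open>\<nu>\<close> has density \<open>L(p)\<close>.  No set has
  smaller boundary (\<open>l_le_outer_boundary\<close>): a component of the complement of the closure whose two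
  sides have masses \<open>p\<close> and \<open>q\<close> contributes \<open>L(p) + L(q) \<ge> L(p + q)\<close> by its end points, which is \<open>L\<close> of
  its own mass, and finitely many components carry almost all the mass of the complement.  Since a
  cylinder over a half-line has the same boundary measure as the half-line, coordinate half-spaces
  attain the lower bound in every dimension.  If \<open>L = \<infinity>\<close> on \<open>{0<..<1}\<close>, a point mass serves as \<open>\<nu>\<close>, because
  no set has measure in \<open>{0<..<1}\<close>.  If \<open>L = 0\<close>, so does a discrete measure on the nonzero integers,
  whose sets of atoms attain all measures in \<open>{0..1}\<close> and have no boundary.\<close>

section \<open>The model profile\<close>

definition model_profile :: "real \<Rightarrow> real \<Rightarrow> real" where
  "model_profile s p = max (p - p powr s) (1 - p - (1 - p) powr s)"

lemma L_fun_model_profile: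
  "L_fun c p = (SUP a\<in>{1/2..1}. ennreal (c a * model_profile (1/a) p))"
  by (simp add: L_fun_def model_profile_def)

lemma model_profile_reflect: "model_profile s (1 - p) = model_profile s p"
  by (simp add: model_profile_def max.commute)

lemma model_profile_0_1 [simp]: "model_profile s 0 = 0" "model_profile s 1 = 0"
  by (simp_all add: model_profile_def)

lemma powr_le_self:
  fixes x s :: real
  assumes "0 \<le> x" "x \<le> 1" "1 \<le> s"
  shows "x powr s \<le> x"
  using powr_mono'[of 1 s x] assms by simp

text \<open>The graph of the concave function \<open>u\<^sup>b\<close> lies below its tangent at \<open>1\<close>.\<close>

lemma powr_le_tangent_at_1:
  fixes u b :: real
  assumes u: "0 \<le> u" and b: "0 \<le> b" "b \<le> 1"
  shows "u powr b \<le> 1 + b * (u - 1)"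
proof (cases "u = 0")
  case False
  then have "exp ((1 - b) * 0 + b * ln u) \<le> (1 - b) * exp 0 + b * exp (ln u)"
    using convex_onD[OF exp_convex, of b 0 "ln u"] b by simp
  then show ?thesis using False u by (simp add: powr_def algebra_simps)
qed (use b in auto)

lemma model_profile_nonneg:
  assumes "0 \<le> p" "p \<le> 1" "1 \<le> s"
  shows "0 \<le> model_profile s p"
  using powr_le_self[OF assms] by (simp add: model_profile_def)

lemma model_profile_le_1:
  assumes "0 \<le> p" "p \<le> 1"
  shows "model_profile s p \<le> 1"
  using assms by (simp add: model_profile_def) (smt (verit) powr_ge_zero)

text \<open>Both functions in the maximum are concave and vanish at \<open>0\<close>; the segment from \<open>0\<close> to \<open>p\<close> is all
  of their concavity that is used later.\<close>

lemma model_profile_scale: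
  assumes p: "0 \<le> p" "p \<le> 1" and t: "0 \<le> t" "t \<le> 1" and s: "1 \<le> s"
  shows "t * model_profile s p \<le> model_profile s (t * p)"
proof -
  have 1: "t * (p - p powr s) \<le> t * p - (t * p) powr s"
    using mult_right_mono[OF powr_le_self[OF t s], of "p powr s"] p t
    by (simp add: powr_mult algebra_simps)
  \<comment> \<open>\<open>1 - t p\<close> is the convex combination \<open>(1 - t) 1 + t (1 - p)\<close>\<close>
  have "(1 - t * p) powr s \<le> (1 - t) + t * (1 - p) powr s"
  proof (cases "p = 1")
    case True
    then show ?thesis using powr_le_self[of "1 - t" s] t s by simp
  next
    case False
    then show ?thesis
      using convex_onD[OF powr_convex[OF s], of t 1 "1 - p"] p t by (simp add: algebra_simps)
  qed
  then have 2: "t * (1 - p - (1 - p) powr s) \<le> 1 - t * p - (1 - t * p) powr s"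
    by (simp add: algebra_simps)
  show ?thesis
    using 1 2 t unfolding model_profile_def by (simp add: max_mult_distrib_left) linarith
qed

lemma model_profile_Lipschitz:
  assumes p: "p \<in> {0..1}" and q: "q \<in> {0..1}" and s: "1 \<le> s" "s \<le> 2"
  shows "\<bar>model_profile s p - model_profile s q\<bar> \<le> 3 * \<bar>p - q\<bar>"
proof -
  have *: "\<bar>x powr s - y powr s\<bar> \<le> 2 * \<bar>x - y\<bar>" if xy: "0 \<le> x" "x \<le> y" "y \<le> 1" for x y :: real
  proof (cases "y = 0")
    case False
    define t where "t = x / y"
    have t: "0 \<le> t" "t \<le> 1" "x = t * y" using False xy by (auto simp: t_def)
    have "t\<^sup>2 \<le> t powr s"
    proof (cases "t = 0")
      case False
      then show ?thesis using powr_mono'[of s 2 t] t s by simp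
    qed simp
    \<comment> \<open>Since \<open>s \<le> 2\<close>, comparison with the square replaces the mean value theorem\<close>
    moreover have "2 * t - 1 \<le> t\<^sup>2" using zero_le_power2[of "t - 1"] by (simp add: power2_diff)
    ultimately have "1 - t powr s \<le> 2 * (1 - t)" by simp
    then have "y powr s * (1 - t powr s) \<le> y * (2 * (1 - t))"
      using powr_le_self[of y s] xy s t powr_le1[of s t] by (intro mult_mono) auto
    moreover have "x powr s \<le> y powr s" using xy s by (intro powr_mono2) auto
    ultimately show ?thesis using xy t by (simp add: powr_mult algebra_simps)
  qed (use xy in auto)
  have **: "\<bar>x powr s - y powr s\<bar> \<le> 2 * \<bar>x - y\<bar>" if "x \<in> {0..1}" "y \<in> {0..1}" for x y :: real
    using *[of x y] *[of y x] that by (cases "x \<le> y") (auto simp: abs_minus_commute)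
  show ?thesis
    using **[OF p q] **[of "1 - p" "1 - q"] p q
    unfolding model_profile_def abs_le_iff max_def by (auto simp: abs_le_iff abs_if split: if_splits)
qed

section \<open>Sections of a set in a product\<close>

context pair_prob_space
begin

lemma section_measures:
  assumes A: "A \<in> sets (M1 \<Otimes>\<^sub>M M2)"
  defines "p \<equiv> \<lambda>y. measure M1 ((\<lambda>x. (x, y)) -` A)" and "q \<equiv> \<lambda>x. measure M2 (Pair x -` A)"
  shows measurable_section_1: "q \<in> borel_measurable M1"
    and measurable_section_2: "p \<in> borel_measurable M2"
    and integral_section_1: "(\<integral>x. q x \<partial>M1) = measure (M1 \<Otimes>\<^sub>M M2) A"
    and integral_section_2: "(\<integral>y. p y \<partial>M2) = measure (M1 \<Otimes>\<^sub>M M2) A"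
proof -
  show q: "q \<in> borel_measurable M1"
    unfolding q_def measure_def using measurable_emeasure_Pair1[OF A] by measurable
  show p: "p \<in> borel_measurable M2"
    unfolding p_def measure_def using measurable_emeasure_Pair2[OF A] by measurable
  have "ennreal (\<integral>x. q x \<partial>M1) = (\<integral>\<^sup>+x. q x \<partial>M1)"
    by (subst nn_integral_eq_integral)
      (auto simp: q_def intro!: M1.integrable_const_bound[where B=1] q[unfolded q_def])
  also have "\<dots> = emeasure (M1 \<Otimes>\<^sub>M M2) A"
    by (subst M2.emeasure_pair_measure_alt[OF A]) (simp add: q_def M2.emeasure_eq_measure)
  finally show "(\<integral>x. q x \<partial>M1) = measure (M1 \<Otimes>\<^sub>M M2) A"
    by (simp add: emeasure_eq_measure integral_nonneg_AE q_def)
  have "ennreal (\<integral>y. p y \<partial>M2) = (\<integral>\<^sup>+y. p y \<partial>M2)"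
    by (subst nn_integral_eq_integral)
      (auto simp: p_def intro!: M2.integrable_const_bound[where B=1] p[unfolded p_def])
  also have "\<dots> = emeasure (M1 \<Otimes>\<^sub>M M2) A"
    by (subst emeasure_pair_measure_alt2[OF A]) (simp add: p_def M1.emeasure_eq_measure)
  finally show "(\<integral>y. p y \<partial>M2) = measure (M1 \<Otimes>\<^sub>M M2) A"
    by (simp add: emeasure_eq_measure integral_nonneg_AE p_def)
qed

text \<open>Let \<open>b = s - 1\<close>.  The mean of \<open>p\<^sub>y\<^sup>s = p\<^sub>y p\<^sub>y\<^sup>b\<close> is the integral of \<open>p\<^sub>y\<^sup>b\<close> over \<open>A\<close>, so the left side is the
  integral of \<open>p\<^sub>y\<^sup>b + q\<^sub>x\<^sup>b\<close> over \<open>A\<close>.  Pointwise this is at most \<open>1 + (p\<^sub>y q\<^sub>x)\<^sup>b\<close>, as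
  \<open>(1 - p\<^sub>y\<^sup>b) (1 - q\<^sub>x\<^sup>b) \<ge> 0\<close>.  The tangent of \<open>t\<^sup>b\<close> at \<open>P\<close> makes the last term affine in \<open>p\<^sub>y q\<^sub>x\<close>, whose
  integral over \<open>A\<close> is at most \<open>P\<^sup>2\<close>.\<close>

lemma section_powr_inequality:
  assumes A: "A \<in> sets (M1 \<Otimes>\<^sub>M M2)" and s: "1 \<le> s" "s \<le> 2"
  defines "p \<equiv> \<lambda>y. measure M1 ((\<lambda>x. (x, y)) -` A)" and "q \<equiv> \<lambda>x. measure M2 (Pair x -` A)"
    and "P \<equiv> measure (M1 \<Otimes>\<^sub>M M2) A"
  shows "(\<integral>y. p y powr s \<partial>M2) + (\<integral>x. q x powr s \<partial>M1) \<le> P + P powr s"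
proof (cases "P = 0")
  case True
  note m = section_measures[OF A, folded p_def q_def P_def]
  note [measurable] = m(1,2)
  have p01: "0 \<le> p y" "p y \<le> 1" and q01: "0 \<le> q x" "q x \<le> 1" for x y by (auto simp: p_def q_def)
  have "(\<integral>y. p y powr s \<partial>M2) \<le> (\<integral>y. p y \<partial>M2)"
    using s p01
    by (intro integral_mono M2.integrable_const_bound[where B=1] AE_I2)
      (auto intro: powr_le_self powr_le1)
  moreover have "(\<integral>x. q x powr s \<partial>M1) \<le> (\<integral>x. q x \<partial>M1)"
    using s q01
    by (intro integral_mono M1.integrable_const_bound[where B=1] AE_I2)
      (auto intro: powr_le_self powr_le1)
  ultimately show ?thesis using m True by simp
next
  case False
  then have P: "P > 0" by (simp add: P_def zero_less_measure_iff)
  define b where "b = s - 1"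
  have b: "0 \<le> b" "b \<le> 1" using s by (auto simp: b_def)
  note m = section_measures[OF A, folded p_def q_def P_def]
  note [measurable] = m(1,2) A
  have p01: "0 \<le> p y" "p y \<le> 1" and q01: "0 \<le> q x" "q x \<le> 1" for x y by (auto simp: p_def q_def)
  have pq1: "p y * q x \<le> 1" for x y using p01 q01 by (simp add: mult_le_one)
  let ?M = "M1 \<Otimes>\<^sub>M M2"
  have int: "integrable ?M f" if "f \<in> borel_measurable ?M" "\<And>z. 0 \<le> f z" "\<And>z. f z \<le> 1" for f :: "_ \<Rightarrow> real"
    using that by (intro integrable_const_bound[where B=1] AE_I2) auto
  define fp where "fp = (\<lambda>z. indicator A z * p (snd z) powr b)"
  define fq where "fq = (\<lambda>z. indicator A z * q (fst z) powr b)"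
  define fpq where "fpq = (\<lambda>z. indicator A z * (p (snd z) * q (fst z)))"
  have ip: "integrable ?M fp" and iq: "integrable ?M fq" and ipq: "integrable ?M fpq"
    unfolding fp_def fq_def fpq_def using p01 q01 b pq1
    by (auto intro!: int mult_le_one powr_le1 simp: mult_nonneg_nonneg split: split_indicator)
  have ipq': "integrable ?M (\<lambda>z. p (snd z) * q (fst z))"
    using p01 q01 pq1 by (intro int) auto
  have iA: "integrable ?M (indicator A :: _ \<Rightarrow> real)"
    by (intro int) (auto split: split_indicator)
  have "(\<integral>y. p y powr s \<partial>M2) = (\<integral>y. (\<integral>x. fp (x, y) \<partial>M1) \<partial>M2)"
  proof (intro Bochner_Integration.integral_cong refl)
    fix y
    have "(\<integral>x. fp (x, y) \<partial>M1) = (\<integral>x. indicator ((\<lambda>x. (x, y)) -` A) x * p y powr b \<partial>M1)"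
      by (simp add: fp_def indicator_def)
    also have "\<dots> = p y * p y powr b"
      using sets_Pair2[OF A, of y] by (simp add: p_def M1.emeasure_eq_measure)
    also have "\<dots> = p y powr s"
      using p01 by (simp add: powr_mult_base b_def)
    finally show "p y powr s = (\<integral>x. fp (x, y) \<partial>M1)" ..
  qed
  also have "\<dots> = integral\<^sup>L ?M fp"
    using integral_snd[of "\<lambda>x y. fp (x, y)"] ip by simp
  finally have 1: "(\<integral>y. p y powr s \<partial>M2) = integral\<^sup>L ?M fp" .
  have "(\<integral>x. q x powr s \<partial>M1) = (\<integral>x. (\<integral>y. fq (x, y) \<partial>M2) \<partial>M1)"
  proof (intro Bochner_Integration.integral_cong refl)
    fix x
    have "(\<integral>y. fq (x, y) \<partial>M2) = (\<integral>y. indicator (Pair x -` A) y * q x powr b \<partial>M2)"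
      by (simp add: fq_def indicator_def)
    also have "\<dots> = q x * q x powr b"
      using sets_Pair1[OF A, of x] by (simp add: q_def M2.emeasure_eq_measure)
    also have "\<dots> = q x powr s"
      using q01 by (simp add: powr_mult_base b_def)
    finally show "q x powr s = (\<integral>y. fq (x, y) \<partial>M2)" ..
  qed
  also have "\<dots> = integral\<^sup>L ?M fq"
    using integral_fst'[OF iq] by simp
  finally have 2: "(\<integral>x. q x powr s \<partial>M1) = integral\<^sup>L ?M fq" .
  \<comment> \<open>Enlarging the domain from \<open>A\<close> to the product separates the variables\<close>
  have "integral\<^sup>L ?M fpq \<le> (\<integral>z. p (snd z) * q (fst z) \<partial>?M)"
    using p01 q01
    by (intro integral_mono ipq ipq') (auto simp: fpq_def split: split_indicator)
  also have "\<dots> = (\<integral>x. (\<integral>y. p y * q x \<partial>M2) \<partial>M1)"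
    using integral_fst'[OF ipq'] by simp
  also have "\<dots> = P * P"
    using m by simp
  finally have 3: "integral\<^sup>L ?M fpq \<le> P * P" .
  \<comment> \<open>The slope of \<open>t\<^sup>b\<close> at \<open>P\<close>\<close>
  define k where "k = b * P powr b / P"
  have k: "0 \<le> k" using b P by (simp add: k_def)
  have pt: "fp z + fq z \<le> (1 + P powr b - k * P) * indicator A z + k * fpq z" for z
  proof (cases "z \<in> A")
    case True
    define u v where "u = p (snd z)" and "v = q (fst z)"
    have uv: "0 \<le> u" "u \<le> 1" "0 \<le> v" "v \<le> 1" using p01 q01 by (auto simp: u_def v_def)
    have "0 \<le> (1 - u powr b) * (1 - v powr b)"
      using uv b by (intro mult_nonneg_nonneg) (auto simp: powr_le1)
    then have "u powr b + v powr b \<le> 1 + (u * v) powr b"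
      using uv by (simp add: powr_mult algebra_simps)
    also have "(u * v) powr b = P powr b * (u * v / P) powr b"
      using uv P by (simp add: powr_divide)
    also have "\<dots> \<le> P powr b * (1 + b * (u * v / P - 1))"
      using uv P b by (intro mult_left_mono powr_le_tangent_at_1) auto
    also have "\<dots> = P powr b - k * P + k * (u * v)"
      using P by (simp add: k_def field_simps)
    finally show ?thesis
      using True by (simp add: fp_def fq_def fpq_def u_def v_def)
  qed (simp add: fp_def fq_def fpq_def)
  have "integral\<^sup>L ?M fp + integral\<^sup>L ?M fq = (\<integral>z. fp z + fq z \<partial>?M)"
    using ip iq by simp
  also have "\<dots> \<le> (\<integral>z. (1 + P powr b - k * P) * indicator A z + k * fpq z \<partial>?M)"
    using ip iq iA ipq pt by (intro integral_mono) auto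
  also have "\<dots> = (1 + P powr b - k * P) * P + k * integral\<^sup>L ?M fpq"
    using iA ipq by (simp add: P_def)
  also have "\<dots> \<le> (1 + P powr b - k * P) * P + k * (P * P)"
    using 3 k by (intro add_left_mono mult_left_mono)
  also have "\<dots> = P + P * P powr b" by (simp add: algebra_simps)
  also have "\<dots> = P + P powr s" using P by (simp add: powr_mult_base b_def)
  finally show ?thesis using 1 2 by simp
qed

text \<open>The previous inequality is the statement for \<open>p - p\<^sup>s\<close>; applied to the complement of \<open>A\<close>, whose
  sections are the complements of the sections of \<open>A\<close>, it gives the other function in the maximum.\<close>

lemma section_model_profile_inequality:
  assumes A: "A \<in> sets (M1 \<Otimes>\<^sub>M M2)" and s: "1 \<le> s" "s \<le> 2"
  shows "model_profile s (measure (M1 \<Otimes>\<^sub>M M2) A) \<le>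
    (\<integral>y. model_profile s (measure M1 ((\<lambda>x. (x, y)) -` A)) \<partial>M2) +
    (\<integral>x. model_profile s (measure M2 (Pair x -` A)) \<partial>M1)"
proof -
  have main: "measure (M1 \<Otimes>\<^sub>M M2) B - measure (M1 \<Otimes>\<^sub>M M2) B powr s \<le>
    (\<integral>y. model_profile s (measure M1 ((\<lambda>x. (x, y)) -` B)) \<partial>M2) +
    (\<integral>x. model_profile s (measure M2 (Pair x -` B)) \<partial>M1)" if B: "B \<in> sets (M1 \<Otimes>\<^sub>M M2)" for B
  proof -
    define p q where "p = (\<lambda>y. measure M1 ((\<lambda>x. (x, y)) -` B))" and "q = (\<lambda>x. measure M2 (Pair x -` B))"
    note m = section_measures[OF B, folded p_def q_def]
    note [measurable] = m(1,2)
    have p01: "0 \<le> p y" "p y \<le> 1" and q01: "0 \<le> q x" "q x \<le> 1" for x y by (auto simp: p_def q_def)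
    have mp: "(\<lambda>y. model_profile s (p y)) \<in> borel_measurable M2"
      and mq: "(\<lambda>x. model_profile s (q x)) \<in> borel_measurable M1"
      unfolding model_profile_def by measurable
    have ip: "integrable M2 p" "integrable M2 (\<lambda>y. p y powr s)" "integrable M2 (\<lambda>y. model_profile s (p y))"
      using p01 s mp
      by (auto intro!: M2.integrable_const_bound[where B=1] AE_I2 powr_le1
          simp: model_profile_nonneg model_profile_le_1)
    have iq: "integrable M1 q" "integrable M1 (\<lambda>y. q y powr s)" "integrable M1 (\<lambda>y. model_profile s (q y))"
      using q01 s mq
      by (auto intro!: M1.integrable_const_bound[where B=1] AE_I2 powr_le1
          simp: model_profile_nonneg model_profile_le_1)
    have "(\<integral>y. p y \<partial>M2) - (\<integral>y. p y powr s \<partial>M2) = (\<integral>y. p y - p y powr s \<partial>M2)"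
      using ip by simp
    also have "\<dots> \<le> (\<integral>y. model_profile s (p y) \<partial>M2)"
      using ip by (intro integral_mono) (auto simp: model_profile_def)
    finally have 1: "(\<integral>y. p y \<partial>M2) - (\<integral>y. p y powr s \<partial>M2) \<le> (\<integral>y. model_profile s (p y) \<partial>M2)" .
    have "(\<integral>y. q y \<partial>M1) - (\<integral>y. q y powr s \<partial>M1) = (\<integral>y. q y - q y powr s \<partial>M1)"
      using iq by simp
    also have "\<dots> \<le> (\<integral>y. model_profile s (q y) \<partial>M1)"
      using iq by (intro integral_mono) (auto simp: model_profile_def)
    finally have 2: "(\<integral>y. q y \<partial>M1) - (\<integral>y. q y powr s \<partial>M1) \<le> (\<integral>y. model_profile s (q y) \<partial>M1)" .
    show ?thesis
      using 1 2 section_powr_inequality[OF B s] m unfolding p_def q_def by simp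
  qed
  let ?C = "space (M1 \<Otimes>\<^sub>M M2) - A"
  have C: "?C \<in> sets (M1 \<Otimes>\<^sub>M M2)" using A by auto
  have sp: "space (M1 \<Otimes>\<^sub>M M2) = space M1 \<times> space M2" by (rule space_pair_measure)
  have 1: "measure M1 ((\<lambda>x. (x, y)) -` ?C) = 1 - measure M1 ((\<lambda>x. (x, y)) -` A)" if "y \<in> space M2" for y
  proof -
    have "(\<lambda>x. (x, y)) -` ?C = space M1 - (\<lambda>x. (x, y)) -` A" using that by (auto simp: sp)
    then show ?thesis using M1.prob_compl[OF sets_Pair2[OF A]] by simp
  qed
  have 2: "measure M2 (Pair x -` ?C) = 1 - measure M2 (Pair x -` A)" if "x \<in> space M1" for x
  proof -
    have "Pair x -` ?C = space M2 - Pair x -` A" using that by (auto simp: sp)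
    then show ?thesis using M2.prob_compl[OF sets_Pair1[OF A]] by simp
  qed
  have "(\<integral>y. model_profile s (measure M1 ((\<lambda>x. (x, y)) -` ?C)) \<partial>M2) =
      (\<integral>y. model_profile s (measure M1 ((\<lambda>x. (x, y)) -` A)) \<partial>M2)"
    by (intro Bochner_Integration.integral_cong) (auto simp: 1 model_profile_reflect)
  moreover have "(\<integral>x. model_profile s (measure M2 (Pair x -` ?C)) \<partial>M1) =
      (\<integral>x. model_profile s (measure M2 (Pair x -` A)) \<partial>M1)"
    by (intro Bochner_Integration.integral_cong) (auto simp: 2 model_profile_reflect)
  ultimately show ?thesis
    using main[OF A] main[OF C] prob_compl[OF A]
    by (subst (1) model_profile_def) simp
qed

end

section \<open>Enlargements\<close>

lemma enlargement_eq: "enlargement X A r = {x \<in> mspace X. \<exists>y\<in>A. mdist X x y < r}"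
  by (auto simp: enlargement_def INF_less_iff)

lemma mdist_self: "x \<in> mspace X \<Longrightarrow> mdist X x x = 0"
  by simp

lemma enlargement_mono: "r \<le> r' \<Longrightarrow> enlargement X A r \<subseteq> enlargement X A r'"
  unfolding enlargement_eq by (blast intro: less_le_trans)

lemma subset_enlargement: "A \<subseteq> mspace X \<Longrightarrow> 0 < r \<Longrightarrow> A \<subseteq> enlargement X A r"
proof
  fix x assume "A \<subseteq> mspace X" "0 < r" "x \<in> A"
  moreover from this have "x \<in> mspace X" "mdist X x x < r" by (auto simp: mdist_self subset_iff)
  ultimately show "x \<in> enlargement X A r" by (auto simp: enlargement_eq intro!: bexI[of _ x])
qed

lemma enlargement_enlargement:
  assumes "A \<subseteq> mspace X"
  shows "enlargement X (enlargement X A r) r' \<subseteq> enlargement X A (r + r')"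
proof
  fix x assume "x \<in> enlargement X (enlargement X A r) r'"
  then obtain y z where "x \<in> mspace X" "y \<in> mspace X" "z \<in> A" "mdist X x y < r'" "mdist X y z < r"
    by (auto simp: enlargement_eq)
  moreover from this have "mdist X x z \<le> mdist X x y + mdist X y z"
    using assms by (intro mdist_triangle) auto
  ultimately show "x \<in> enlargement X A (r + r')"
    by (auto simp: enlargement_eq intro!: bexI[of _ z])
qed

lemma openin_enlargement:
  assumes "A \<subseteq> mspace X"
  shows "openin (mtopology_of X) (enlargement X A r)"
  unfolding openin_mtopology_of_iff
proof (intro conjI ballI)
  fix x assume "x \<in> enlargement X A r"
  then obtain z where z: "x \<in> mspace X" "z \<in> A" "mdist X x z < r" by (auto simp: enlargement_eq)
  have "y \<in> enlargement X A r" if y: "y \<in> mspace X" "mdist X x y < r - mdist X x z" for y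
  proof -
    have "mdist X y z \<le> mdist X y x + mdist X x z"
      using assms z y by (intro mdist_triangle) auto
    then show ?thesis using y z by (auto simp: enlargement_eq mdist_commute intro!: bexI[of _ z])
  qed
  then show "\<exists>e>0. \<forall>y\<in>mspace X. mdist X x y < e \<longrightarrow> y \<in> enlargement X A r"
    using z by (intro exI[of _ "r - mdist X x z"]) auto
qed (auto simp: enlargement_eq)

lemma openin_sets:
  assumes "metric_prob_space X \<mu>" "openin (mtopology_of X) U"
  shows "U \<in> sets \<mu>"
  using assms by (auto simp: metric_prob_space_def borel_sets_of_def intro: sigma_sets.Basic)

lemma borel_sets_subset: "A \<in> borel_sets_of X \<Longrightarrow> A \<subseteq> mspace X"
  unfolding borel_sets_of_def by (erule sigma_sets_into_sp[rotated]) (auto simp: openin_mtopology_of_iff)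

section \<open>Boundary measure and growth of open sets\<close>

text \<open>Jumps of the monotone function \<open>u\<close> are upward.  Therefore the set of \<open>t\<close> up to
  which growth of rate \<open>k\<close> has persisted contains its supremum, and the derivative bound excludes a
  supremum below \<open>R\<close>.\<close>

lemma growth_of_lower_dini_derivative:
  fixes u :: "real \<Rightarrow> real"
  assumes R: "0 < R" and mono: "\<And>s t. 0 \<le> s \<Longrightarrow> s \<le> t \<Longrightarrow> t \<le> R \<Longrightarrow> u s \<le> u t"
    and dini: "\<And>t k. 0 \<le> t \<Longrightarrow> t < R \<Longrightarrow> 0 \<le> k \<Longrightarrow> k < d \<Longrightarrow>
      eventually (\<lambda>h. u t + k * h \<le> u (t + h)) (at_right 0)"
  shows "u 0 + d * R \<le> u R"
proof (rule ccontr)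
  assume neg: "\<not> ?thesis"
  \<comment> \<open>The mean growth rate \<open>k\<close> is assumed too small; \<open>k'\<close> lies strictly between it and \<open>d\<close>\<close>
  define k where "k = (u R - u 0) / R"
  have uR: "u 0 \<le> u R" using mono R by simp
  have kd2: "u R - u 0 = k * R" using R by (simp add: k_def)
  have "k * R < d * R" using neg kd2 by linarith
  then have kd: "k < d" using R by simp
  have k0: "0 \<le> k" using R uR by (simp add: k_def)
  define k' where "k' = (k + d) / 2"
  have k': "0 \<le> k'" "k < k'" "k' < d" using kd k0 by (auto simp: k'_def)
  define S where "S = {t\<in>{0..R}. u 0 + k' * t \<le> u t}"
  define T where "T = Sup S"
  have S0: "0 \<in> S" using R by (auto simp: S_def)
  have bdd: "bdd_above S" by (intro bdd_aboveI[of _ R]) (auto simp: S_def)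
  have "T \<le> R" unfolding T_def by (rule cSup_least) (use S0 in \<open>auto simp: S_def\<close>)
  then have T: "0 \<le> T" "T \<le> R"
    using cSup_upper[OF S0 bdd] by (auto simp: T_def)
  have "u 0 + k' * T \<le> u T"
  proof (rule ccontr)
    assume a: "\<not> u 0 + k' * T \<le> u T"
    have uT: "u 0 \<le> u T" using mono T by simp
    with a have kT: "0 < k' * T" by linarith
    then have kp: "k' > 0" using T k' by (auto simp: zero_less_mult_iff)
    have "(u T - u 0) / k' < T" using a kp by (simp add: field_simps)
    then obtain t where t: "t \<in> S" "(u T - u 0) / k' < t"
      using less_cSup_iff[of S "(u T - u 0) / k'"] S0 bdd by (auto simp: T_def)
    have "t \<le> T" using cSup_upper[OF t(1) bdd] by (simp add: T_def)
    then have "u t \<le> u T" using mono t T by (auto simp: S_def)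
    then show False using t kp by (auto simp: S_def field_simps)
  qed
  show False
  proof (cases "T = R")
    case True
    then show False using \<open>u 0 + k' * T \<le> u T\<close> kd2 mult_strict_right_mono[OF k'(2) R] by simp
  next
    case False
    then have TR: "T < R" using T by simp
    have "eventually (\<lambda>h. h \<in> {0<..<R - T}) (at_right (0::real))"
      using TR by (intro eventually_at_right_real) auto
    then have "eventually (\<lambda>h. u T + k' * h \<le> u (T + h) \<and> h \<in> {0<..<R - T}) (at_right 0)"
      using dini[OF T(1) TR k'(1,3)] by eventually_elim auto
    then obtain h where h: "u T + k' * h \<le> u (T + h)" "0 < h" "h < R - T"
      by (auto dest!: eventually_happens)
    then have "T + h \<in> S"
      using \<open>u 0 + k' * T \<le> u T\<close> T by (auto simp: S_def algebra_simps)
    then have "T + h \<le> T" unfolding T_def by (intro cSup_upper bdd)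
    then show False using h by simp
  qed
qed

text \<open>Open sets are singled out because enlarging an open set of a product in one coordinate gives an
  open, hence measurable, set; for a general Borel set the result is a projection of a Borel set.\<close>

definition open_growth :: "'a metric \<Rightarrow> 'a measure \<Rightarrow> (real \<Rightarrow> real) \<Rightarrow> bool" where
  "open_growth X \<mu> J \<longleftrightarrow> (\<exists>K\<ge>0. \<forall>U r. openin (mtopology_of X) U \<longrightarrow> 0 < r \<longrightarrow>
     measure \<mu> U + r * J (measure \<mu> U) - K * r\<^sup>2 \<le> measure \<mu> (enlargement X U r))"

text \<open>The hypothesis bounds the lower right derivative of the function sending \<open>t\<close> to the measure of
  \<open>U\<^sub>t\<close>, at \<open>0\<close> by the bound for \<open>U\<close> and at \<open>t > 0\<close> by that for \<open>U\<^sub>t\<close>.  If the total growth reaches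
  \<open>c r\<close>, nothing is left to prove since \<open>J \<le> c\<close>; otherwise the measure stays within \<open>c r\<close> of its initial
  value, and the Lipschitz property keeps \<open>J\<close> almost constant.\<close>

lemma open_growth_of_boundary:
  assumes X: "metric_prob_space X \<mu>" and c: "0 \<le> c" and s: "1 \<le> s" "s \<le> 2"
    and bd: "\<And>A. A \<in> borel_sets_of X \<Longrightarrow>
      ennreal (c * model_profile s (measure \<mu> A)) \<le> outer_boundary X \<mu> A"
  shows "open_growth X \<mu> (\<lambda>p. c * model_profile s p)"
  unfolding open_growth_def
proof (intro exI[of _ "3 * c * c"] conjI allI impI)
  interpret prob_space \<mu> using X by (simp add: metric_prob_space_def)
  fix U r assume U: "openin (mtopology_of X) U" and r: "0 < (r::real)"
  define J where "J = (\<lambda>p. c * model_profile s p)"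
  have UX: "U \<subseteq> mspace X" using U by (auto simp: openin_mtopology_of_iff)
  \<comment> \<open>\<open>enlargement X U 0\<close> is empty, so the initial set is put in by hand\<close>
  define E where "E = (\<lambda>t. if t = 0 then U else enlargement X U t)"
  define u where "u = (\<lambda>t. measure \<mu> (E t))"
  have EX: "E t \<subseteq> mspace X" for t using UX by (auto simp: E_def enlargement_eq)
  have Eset: "E t \<in> sets \<mu>" for t
    using openin_sets[OF X] U openin_enlargement[OF UX] by (auto simp: E_def)
  have Emono: "E a \<subseteq> E b" if "0 \<le> a" "a \<le> b" for a b
    using that enlargement_mono[of a b X U] subset_enlargement[OF UX, of b] by (auto simp: E_def)
  have umono: "u a \<le> u b" if "0 \<le> a" "a \<le> b" for a b
    using Emono[OF that] Eset by (auto simp: u_def intro: finite_measure_mono)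
  have u01: "0 \<le> u t" "u t \<le> 1" for t by (auto simp: u_def)
  have Jc: "J (u 0) \<le> c" using model_profile_le_1[of "u 0" s] u01 c by (simp add: J_def mult_left_le)
  have "u 0 + r * J (u 0) - 3 * c * c * r\<^sup>2 \<le> u r"
  proof (cases "u r - u 0 \<ge> c * r")
    case True
    then show ?thesis using Jc r c
      by (smt (verit) mult.commute mult_left_mono mult_nonneg_nonneg zero_le_power2)
  next
    case False
    define d where "d = J (u 0) - 3 * c * (c * r)"
    have "u 0 + d * r \<le> u r"
    proof (rule growth_of_lower_dini_derivative[OF r])
      fix t k assume t: "0 \<le> t" "t < r" and k: "0 \<le> k" "k < d"
      have "u t - u 0 \<le> c * r" "0 \<le> u t - u 0" using umono[of t r] umono[of 0 t] t False by auto
      then have "\<bar>model_profile s (u t) - model_profile s (u 0)\<bar> \<le> 3 * (c * r)"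
        using model_profile_Lipschitz[of "u t" "u 0" s] u01 s by auto
      then have "c * model_profile s (u 0) - c * model_profile s (u t) \<le> c * (3 * (c * r))"
        unfolding right_diff_distrib[symmetric] using c by (intro mult_left_mono) auto
      then have kJ: "k < J (u t)" using k by (simp add: d_def J_def)
      have "E t \<in> borel_sets_of X" using Eset X by (auto simp: metric_prob_space_def)
      from bd[OF this] have "ennreal (J (u t)) \<le> outer_boundary X \<mu> (E t)" by (simp add: J_def u_def)
      moreover have "ennreal k < ennreal (J (u t))" using kJ k by (simp add: ennreal_lessI)
      ultimately have "eventually (\<lambda>h. ennreal k < ennreal ((measure \<mu> (enlargement X (E t) h) - u t) / h)) (at_right 0)"
        unfolding outer_boundary_def u_def le_Liminf_iff by blast
      moreover have "eventually (\<lambda>h. h > 0) (at_right (0::real))" by (rule eventually_at_right_less)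
      ultimately show "eventually (\<lambda>h. u t + k * h \<le> u (t + h)) (at_right 0)"
      proof eventually_elim
        case (elim h)
        have "enlargement X (E t) h \<subseteq> E (t + h)"
          using enlargement_enlargement[OF UX, of t h] elim t by (auto simp: E_def)
        then have le: "measure \<mu> (enlargement X (E t) h) \<le> u (t + h)"
          unfolding u_def by (intro finite_measure_mono Eset)
        have "k < (measure \<mu> (enlargement X (E t) h) - u t) / h"
          using elim(1) k by (simp add: ennreal_less_iff)
        then show ?case using elim(2) le by (simp add: field_simps)
      qed
    qed (use umono in auto)
    then show ?thesis by (simp add: d_def algebra_simps power2_eq_square)
  qed
  then show "measure \<mu> U + r * (c * model_profile s (measure \<mu> U)) - 3 * c * c * r\<^sup>2 \<le>
      measure \<mu> (enlargement X U r)"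
    using r by (simp add: u_def E_def J_def)
qed (use c in auto)

text \<open>For an arbitrary Borel set \<open>A\<close> a small part \<open>e r\<close> of the enlargement is spent to replace \<open>A\<close> by the
  open set \<open>A\<close> enlarged by \<open>e r\<close>; then \<open>e\<close> tends to \<open>0\<close> with \<open>r\<close> fixed.\<close>

lemma boundary_of_open_growth:
  assumes X: "metric_prob_space X \<mu>" and c: "0 \<le> c" and s: "1 \<le> s" "s \<le> 2"
    and gr: "open_growth X \<mu> (\<lambda>p. c * model_profile s p)" and A: "A \<in> borel_sets_of X"
  shows "ennreal (c * model_profile s (measure \<mu> A)) \<le> outer_boundary X \<mu> A"
proof -
  interpret prob_space \<mu> using X by (simp add: metric_prob_space_def)
  define J where "J = (\<lambda>p. c * model_profile s p)"
  obtain K where K: "0 \<le> K" and grow: "\<And>U r. openin (mtopology_of X) U \<Longrightarrow> 0 < r \<Longrightarrow>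
     measure \<mu> U + r * J (measure \<mu> U) - K * r\<^sup>2 \<le> measure \<mu> (enlargement X U r)"
    using gr unfolding open_growth_def J_def by blast
  have AX: "A \<subseteq> mspace X" by (rule borel_sets_subset[OF A])
  have As: "A \<in> sets \<mu>" using A X by (simp add: metric_prob_space_def)
  define p where "p = measure \<mu> A"
  have Es: "enlargement X A r \<in> sets \<mu>" for r
    by (intro openin_sets[OF X] openin_enlargement AX)
  have p01: "0 \<le> p" "p \<le> 1" by (auto simp: p_def)
  have Jc: "J p \<le> c" using model_profile_le_1[of p s] p01 c by (simp add: J_def mult_left_le)
  have J0: "0 \<le> J p" using model_profile_nonneg[of p s] p01 c s by (simp add: J_def)
  have main: "J p - (3 * c * c + K) * r \<le> (measure \<mu> (enlargement X A r) - p) / r" (is "_ \<le> ?D / r")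
    if r: "0 < r" for r
  proof (cases "c * r \<le> ?D")
    case True
    then have "c \<le> ?D / r" using r by (simp add: field_simps)
    moreover have "0 \<le> (3 * c * c + K) * r" using c K r by simp
    ultimately show ?thesis using Jc by linarith
  next
    case False
    have "J p - (3 * c * c + K) * r - e * c \<le> ?D / r" if e: "0 < e" "e < 1" for e
    proof -
      define B where "B = enlargement X A (e * r)"
      define b where "b = measure \<mu> B"
      have er: "0 < e * r" "0 < (1 - e) * r" "e * r \<le> r" using e r by auto
      have Bop: "openin (mtopology_of X) B" unfolding B_def by (rule openin_enlargement[OF AX])
      have pb: "p \<le> b" unfolding p_def b_def B_def
        by (intro finite_measure_mono subset_enlargement AX er Es)
      have "b \<le> measure \<mu> (enlargement X A r)" unfolding b_def B_def
        by (intro finite_measure_mono enlargement_mono er Es)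
      then have "b - p \<le> c * r" using False by linarith
      moreover have "b \<le> 1" by (simp add: b_def)
      ultimately have "\<bar>model_profile s b - model_profile s p\<bar> \<le> 3 * (c * r)"
        using model_profile_Lipschitz[of b p s] p01 s pb by auto
      then have "c * model_profile s p - c * model_profile s b \<le> c * (3 * (c * r))"
        unfolding right_diff_distrib[symmetric] using c by (intro mult_left_mono) auto
      then have Jb: "J p - 3 * c * c * r \<le> J b" by (simp add: J_def)
      have "enlargement X B ((1 - e) * r) \<subseteq> enlargement X A r"
        using enlargement_enlargement[OF AX, of "e * r" "(1 - e) * r"] by (simp add: B_def algebra_simps)
      then have "measure \<mu> (enlargement X B ((1 - e) * r)) \<le> measure \<mu> (enlargement X A r)"
        by (intro finite_measure_mono Es)
      with grow[OF Bop er(2)] have "b + (1 - e) * r * J b - K * ((1 - e) * r)\<^sup>2 \<le> measure \<mu> (enlargement X A r)"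
        unfolding b_def by linarith
      moreover have "K * ((1 - e) * r)\<^sup>2 \<le> K * r\<^sup>2"
        using K e r by (intro mult_left_mono power_mono) (auto simp: mult_left_le_one_le)
      ultimately have "(1 - e) * r * J b - K * r\<^sup>2 \<le> ?D" using pb by linarith
      moreover have "(1 - e) * r * (J p - 3 * c * c * r) \<le> (1 - e) * r * J b"
        using Jb er by (intro mult_left_mono) auto
      ultimately have "r * ((1 - e) * (J p - 3 * c * c * r) - K * r) \<le> ?D"
        by (simp add: algebra_simps power2_eq_square)
      then have "(1 - e) * (J p - 3 * c * c * r) - K * r \<le> ?D / r"
        using r by (simp add: field_simps)
      moreover have "J p - 3 * c * c * r - e * c \<le> (1 - e) * (J p - 3 * c * c * r)"
      proof -
        define Z where "Z = 3 * c * c * r"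
        have "0 \<le> e * Z" using e c r by (simp add: Z_def)
        moreover have "(1 - e) * (J p - Z) = J p - Z - e * J p + e * Z" by (simp add: algebra_simps)
        moreover have "e * J p \<le> e * c" using Jc e by simp
        ultimately show ?thesis unfolding Z_def[symmetric] by linarith
      qed
      ultimately show ?thesis by (simp add: algebra_simps)
    qed
    note e = this
    have "((\<lambda>e. J p - (3 * c * c + K) * r - e * c) \<longlongrightarrow> J p - (3 * c * c + K) * r - 0 * c) (at_right 0)"
      by (intro tendsto_intros)
    moreover have "eventually (\<lambda>e. e \<in> {0<..<1}) (at_right (0::real))"
      by (intro eventually_at_right_real) auto
    then have "eventually (\<lambda>e. J p - (3 * c * c + K) * r - e * c \<le> ?D / r) (at_right 0)"
      by eventually_elim (use e in auto)
    ultimately show ?thesis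
      by (intro tendsto_upperbound[where F="at_right 0"]) auto
  qed
  have "((\<lambda>r. ennreal (J p - (3 * c * c + K) * r)) \<longlongrightarrow> ennreal (J p - (3 * c * c + K) * 0)) (at_right 0)"
    by (intro tendsto_ennrealI tendsto_intros)
  then have "Liminf (at_right 0) (\<lambda>r. ennreal (J p - (3 * c * c + K) * r)) = ennreal (J p)"
    by (intro lim_imp_Liminf) auto
  moreover have "Liminf (at_right 0) (\<lambda>r. ennreal (J p - (3 * c * c + K) * r)) \<le> outer_boundary X \<mu> A"
    unfolding outer_boundary_def p_def[symmetric]
    by (intro Liminf_mono eventually_mono[OF eventually_at_right_less] ennreal_leI main)
  ultimately show ?thesis by (simp add: J_def p_def)
qed

section \<open>Growth in products\<close>

text \<open>Here \<open>S1\<close> is \<open>S\<close> enlarged in the first coordinate, and \<open>S2\<close> is \<open>S1\<close> enlarged in the second.  The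
  second step sees the sections of \<open>S1\<close> instead of those of \<open>S\<close>, which changes the mean of the profile
  by at most three times the growth in the first step.  Unless the total growth already exceeds \<open>c r\<close>, this
  is a further error of order \<open>r\<^sup>2\<close>.\<close>

lemma (in pair_prob_space) two_step_growth:
  assumes sets: "S \<in> sets (M1 \<Otimes>\<^sub>M M2)" "S1 \<in> sets (M1 \<Otimes>\<^sub>M M2)" "S2 \<in> sets (M1 \<Otimes>\<^sub>M M2)"
    and sub: "S \<subseteq> S1" "S1 \<subseteq> S2"
    and c: "0 \<le> c" and s: "1 \<le> s" "s \<le> 2" and r: "0 < r" and K: "0 \<le> K1" "0 \<le> K2"
    and g1: "\<And>y. y \<in> space M2 \<Longrightarrow>
      measure M1 ((\<lambda>x. (x, y)) -` S) + r * (c * model_profile s (measure M1 ((\<lambda>x. (x, y)) -` S))) - K1 * r\<^sup>2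
        \<le> measure M1 ((\<lambda>x. (x, y)) -` S1)"
    and g2: "\<And>x. x \<in> space M1 \<Longrightarrow>
      measure M2 (Pair x -` S1) + r * (c * model_profile s (measure M2 (Pair x -` S1))) - K2 * r\<^sup>2
        \<le> measure M2 (Pair x -` S2)"
  defines "P \<equiv> measure (M1 \<Otimes>\<^sub>M M2)"
  shows "P S + r * (c * model_profile s (P S)) - (K1 + K2 + 3 * c * c) * r\<^sup>2 \<le> P S2"
proof -
  define p where "p = (\<lambda>(S :: ('a \<times> 'b) set) y. measure M1 ((\<lambda>x. (x, y)) -` S))"
  define q where "q = (\<lambda>(S :: ('a \<times> 'b) set) x. measure M2 (Pair x -` S))"
  let ?m = "model_profile s"
  have p01: "0 \<le> p S y" "p S y \<le> 1" and q01: "0 \<le> q S x" "q S x \<le> 1" for S x y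
    by (auto simp: p_def q_def)
  have P01: "0 \<le> P S" "P S \<le> 1" for S by (auto simp: P_def)
  have meas: "p A \<in> borel_measurable M2" "q A \<in> borel_measurable M1"
    and int: "(\<integral>y. p A y \<partial>M2) = P A" "(\<integral>x. q A x \<partial>M1) = P A"
    if "A \<in> sets (M1 \<Otimes>\<^sub>M M2)" for A
    using section_measures[OF that] unfolding p_def q_def P_def by auto
  have ip: "integrable M2 (p A)" "integrable M2 (\<lambda>y. ?m (p A y))"
    and iq: "integrable M1 (q A)" "integrable M1 (\<lambda>x. ?m (q A x))"
    if A: "A \<in> sets (M1 \<Otimes>\<^sub>M M2)" for A
  proof -
    note [measurable] = meas[OF A]
    have "(\<lambda>y. ?m (p A y)) \<in> borel_measurable M2" "(\<lambda>x. ?m (q A x)) \<in> borel_measurable M1"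
      unfolding model_profile_def by measurable
    then show "integrable M2 (p A)" "integrable M2 (\<lambda>y. ?m (p A y))"
      "integrable M1 (q A)" "integrable M1 (\<lambda>x. ?m (q A x))"
      using p01 q01 s
      by (auto intro!: M1.integrable_const_bound[where B=1] M2.integrable_const_bound[where B=1]
          AE_I2 simp: model_profile_nonneg model_profile_le_1)
  qed
  have P1: "P S \<le> P S1" and P2: "P S1 \<le> P S2"
    unfolding P_def using sets sub by (auto intro: finite_measure_mono)
  have A: "P S + r * (c * (\<integral>y. ?m (p S y) \<partial>M2)) - K1 * r\<^sup>2 \<le> P S1"
  proof -
    have "P S + r * (c * (\<integral>y. ?m (p S y) \<partial>M2)) - K1 * r\<^sup>2 =
      (\<integral>y. p S y + r * (c * ?m (p S y)) - K1 * r\<^sup>2 \<partial>M2)"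
      using ip[OF sets(1)] by (simp add: int[OF sets(1)] M2.prob_space)
    also have "\<dots> \<le> (\<integral>y. p S1 y \<partial>M2)"
      using ip[OF sets(1)] ip[OF sets(2)] g1 by (intro integral_mono) (auto simp: p_def)
    finally show ?thesis by (simp add: int[OF sets(2)])
  qed
  have B: "P S1 + r * (c * (\<integral>x. ?m (q S1 x) \<partial>M1)) - K2 * r\<^sup>2 \<le> P S2"
  proof -
    have "P S1 + r * (c * (\<integral>x. ?m (q S1 x) \<partial>M1)) - K2 * r\<^sup>2 =
      (\<integral>x. q S1 x + r * (c * ?m (q S1 x)) - K2 * r\<^sup>2 \<partial>M1)"
      using iq[OF sets(2)] by (simp add: int[OF sets(2)] M1.prob_space)
    also have "\<dots> \<le> (\<integral>x. q S2 x \<partial>M1)"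
      using iq[OF sets(2)] iq[OF sets(3)] g2 by (intro integral_mono) (auto simp: q_def)
    finally show ?thesis by (simp add: int[OF sets(3)])
  qed
  have C: "(\<integral>x. ?m (q S x) \<partial>M1) - 3 * (P S1 - P S) \<le> (\<integral>x. ?m (q S1 x) \<partial>M1)"
  proof -
    have "(\<integral>x. ?m (q S x) \<partial>M1) - 3 * (P S1 - P S) =
      (\<integral>x. ?m (q S x) - 3 * (q S1 x - q S x) \<partial>M1)"
      using iq[OF sets(1)] iq[OF sets(2)] by (simp add: int[OF sets(1)] int[OF sets(2)])
    also have "\<dots> \<le> (\<integral>x. ?m (q S1 x) \<partial>M1)"
    proof (intro integral_mono)
      fix x
      have "q S x \<le> q S1 x"
        unfolding q_def using sub sets_Pair1[OF sets(2)] by (intro M2.finite_measure_mono) auto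
      then show "?m (q S x) - 3 * (q S1 x - q S x) \<le> ?m (q S1 x)"
        using model_profile_Lipschitz[of "q S x" "q S1 x" s] q01 s by auto
    qed (use iq[OF sets(1)] iq[OF sets(2)] in auto)
    finally show ?thesis .
  qed
  have D: "?m (P S) \<le> (\<integral>y. ?m (p S y) \<partial>M2) + (\<integral>x. ?m (q S x) \<partial>M1)"
    using section_model_profile_inequality[OF sets(1) s] by (simp add: p_def q_def P_def)
  show ?thesis
  proof (cases "c * r \<le> P S2 - P S")
    case True
    have "c * ?m (P S) \<le> c"
      using model_profile_le_1[of "P S" s] P01 c by (simp add: mult_left_le)
    then have "r * (c * ?m (P S)) \<le> r * c" using r by simp
    moreover have "0 \<le> (K1 + K2 + 3 * c * c) * r\<^sup>2" using K c by simp
    ultimately show ?thesis using True by (simp add: mult.commute)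
  next
    case False
    then have "P S1 - P S \<le> c * r" using P2 by linarith
    then have "3 * (P S1 - P S) \<le> 3 * (c * r)" by simp
    with C D have "?m (P S) - 3 * (c * r) \<le> (\<integral>y. ?m (p S y) \<partial>M2) + (\<integral>x. ?m (q S1 x) \<partial>M1)"
      by argo
    then have "r * c * (?m (P S) - 3 * (c * r)) \<le>
        r * c * ((\<integral>y. ?m (p S y) \<partial>M2) + (\<integral>x. ?m (q S1 x) \<partial>M1))"
      using r c by (intro mult_left_mono) auto
    then show ?thesis using A B by (simp add: algebra_simps power2_eq_square)
  qed
qed

text \<open>The next two definitions describe enlargements and open sets for the supremum distance by
  conditions on coordinates.  They also make sense for the empty index set, at which the induction on
  the number of factors starts.\<close>

definition box_enlargement :: "'a metric \<Rightarrow> 'i set \<Rightarrow> ('i \<Rightarrow> 'a) set \<Rightarrow> real \<Rightarrow> ('i \<Rightarrow> 'a) set" where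
  "box_enlargement X I A r = {x \<in> \<Pi>\<^sub>E i\<in>I. mspace X. \<exists>y\<in>A. \<forall>i\<in>I. mdist X (x i) (y i) < r}"

definition box_open :: "'a metric \<Rightarrow> 'i set \<Rightarrow> ('i \<Rightarrow> 'a) set \<Rightarrow> bool" where
  "box_open X I A \<longleftrightarrow> A \<subseteq> (\<Pi>\<^sub>E i\<in>I. mspace X) \<and>
     (\<forall>x\<in>A. \<exists>e>0. \<forall>y\<in>\<Pi>\<^sub>E i\<in>I. mspace X. (\<forall>i\<in>I. mdist X (x i) (y i) < e) \<longrightarrow> y \<in> A)"

lemma box_openE:
  assumes "box_open X I A" "x \<in> A"
  obtains e where "e > 0"
    "\<And>w. w \<in> (\<Pi>\<^sub>E i\<in>I. mspace X) \<Longrightarrow> \<forall>i\<in>I. mdist X (x i) (w i) < e \<Longrightarrow> w \<in> A"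
proof -
  have "\<forall>x\<in>A. \<exists>e>0. \<forall>y\<in>\<Pi>\<^sub>E i\<in>I. mspace X. (\<forall>i\<in>I. mdist X (x i) (y i) < e) \<longrightarrow> y \<in> A"
    using assms(1) by (simp add: box_open_def)
  from bspec[OF this assms(2)] obtain e where
    "e > 0" "\<forall>y\<in>\<Pi>\<^sub>E i\<in>I. mspace X. (\<forall>i\<in>I. mdist X (x i) (y i) < e) \<longrightarrow> y \<in> A" by (elim exE conjE)
  then show thesis by (intro that[of e]) (auto simp only:)
qed

lemma mdist_funspace_less:
  assumes "finite I" "I \<noteq> {}" "x \<in> (\<Pi>\<^sub>E i\<in>I. mspace X)" "y \<in> (\<Pi>\<^sub>E i\<in>I. mspace X)"
  shows "mdist (funspace I X) x y < r \<longleftrightarrow> (\<forall>i\<in>I. mdist X (x i) (y i) < r)"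
  using assms by (simp add: mdist_funspace_finite del: mdist_funspace)

lemma enlargement_funspace:
  assumes "finite I" "I \<noteq> {}" "A \<subseteq> (\<Pi>\<^sub>E i\<in>I. mspace X)"
  shows "enlargement (funspace I X) A r = box_enlargement X I A r"
  unfolding enlargement_eq box_enlargement_def mspace_funspace_finite[OF assms(1)]
  by (intro Collect_cong conj_cong bex_cong refl mdist_funspace_less[OF assms(1,2)])
    (use assms(3) in blast)+

lemma openin_funspace:
  assumes "finite I" "I \<noteq> {}"
  shows "openin (mtopology_of (funspace I X)) A \<longleftrightarrow> box_open X I A"
proof (cases "A \<subseteq> (\<Pi>\<^sub>E i\<in>I. mspace X)")
  case True
  have "mdist (funspace I X) x y < e \<longleftrightarrow> (\<forall>i\<in>I. mdist X (x i) (y i) < e)"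
    if "x \<in> A" "y \<in> (\<Pi>\<^sub>E i\<in>I. mspace X)" for x y e
    by (rule mdist_funspace_less[OF assms]) (use True that in blast)+
  then show ?thesis
    unfolding openin_mtopology_of_iff box_open_def mspace_funspace_finite[OF assms(1)]
    by (intro conj_cong refl ball_cong ex_cong1 imp_cong) (simp only:)
next
  case False
  then show ?thesis
    unfolding openin_mtopology_of_iff box_open_def mspace_funspace_finite[OF assms(1)] by blast
qed

text \<open>A point \<open>y\<close> of \<open>U\<close> that witnesses \<open>z\<close> can be moved along the coordinates in \<open>I\<close> together with \<open>z\<close>,
  because \<open>U\<close> contains a neighbourhood of \<open>y\<close>.\<close>

lemma box_enlargement_insert_open:
  assumes U: "box_open X (insert i I) U" and I: "finite I" "i \<notin> I"
  shows "box_open X (insert i I)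
    {z \<in> \<Pi>\<^sub>E k\<in>insert i I. mspace X. \<exists>y\<in>U. mdist X (z i) (y i) < r \<and> (\<forall>k\<in>I. y k = z k)}"
    (is "box_open _ _ ?V")
  unfolding box_open_def
proof (intro conjI ballI)
  let ?W = "\<Pi>\<^sub>E k\<in>insert i I. mspace X"
  fix z assume "z \<in> ?V"
  then obtain y where y: "z \<in> ?W" "y \<in> U" "mdist X (z i) (y i) < r" "\<forall>k\<in>I. y k = z k" by auto
  have yW: "y \<in> ?W" using y U by (auto simp: box_open_def)
  obtain e where e: "e > 0" "\<And>w. w \<in> ?W \<Longrightarrow> \<forall>k\<in>insert i I. mdist X (y k) (w k) < e \<Longrightarrow> w \<in> U"
    using box_openE[OF U y(2)] by auto
  define d where "d = min e (r - mdist X (z i) (y i))"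
  have "w \<in> ?V" if w: "w \<in> ?W" "\<forall>k\<in>insert i I. mdist X (z k) (w k) < d" for w
  proof -
    have yi: "y i \<in> mspace X" "w i \<in> mspace X" "z i \<in> mspace X" 
      using PiE_mem[OF yW] PiE_mem[OF w(1)] PiE_mem[OF y(1)] by blast+
    have "w(i := y i) \<in> ?W" using w yW by (auto simp: PiE_iff extensional_def)
    moreover have "mdist X (y k) ((w(i := y i)) k) < e" if "k \<in> insert i I" for k
    proof (cases "k = i")
      case True
      then show ?thesis using yi e by (simp add: mdist_self)
    next
      case False
      then show ?thesis using that w(2) y(4) by (auto simp: d_def)
    qed
    ultimately have "w(i := y i) \<in> U" using e by blast
    moreover have "mdist X (w i) (y i) \<le> mdist X (w i) (z i) + mdist X (z i) (y i)"
      using yi by (intro mdist_triangle)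
    then have "mdist X (w i) (y i) < r" using w(2) by (auto simp: d_def mdist_commute)
    ultimately show ?thesis using w I by (auto intro!: bexI[of _ "w(i := y i)"])
  qed
  then show "\<exists>d>0. \<forall>w\<in>?W. (\<forall>k\<in>insert i I. mdist X (z k) (w k) < d) \<longrightarrow> w \<in> ?V"
    using e y by (intro exI[of _ d]) (auto simp: d_def)
qed auto

lemma box_open_section_insert:
  assumes V: "box_open X (insert i I) V" and I: "i \<notin> I" and t: "t \<in> mspace X"
  shows "box_open X I {x \<in> \<Pi>\<^sub>E k\<in>I. mspace X. x(i := t) \<in> V}"
  unfolding box_open_def
proof (intro conjI ballI)
  fix x assume x: "x \<in> {x \<in> \<Pi>\<^sub>E k\<in>I. mspace X. x(i := t) \<in> V}"
  then have xV: "x(i := t) \<in> V" by simp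
  obtain e where e: "e > 0" "\<And>w. w \<in> (\<Pi>\<^sub>E k\<in>insert i I. mspace X) \<Longrightarrow>
      \<forall>k\<in>insert i I. mdist X ((x(i := t)) k) (w k) < e \<Longrightarrow> w \<in> V"
    using box_openE[OF V xV] by auto
  have "w(i := t) \<in> V" if w: "w \<in> (\<Pi>\<^sub>E k\<in>I. mspace X)" "\<forall>k\<in>I. mdist X (x k) (w k) < e" for w
  proof (rule e(2))
    show "w(i := t) \<in> (\<Pi>\<^sub>E k\<in>insert i I. mspace X)"
      using w t by (auto simp: PiE_iff extensional_def)
    have "mdist X t t < e" using mdist_self[OF t] e(1) by simp
    then show "\<forall>k\<in>insert i I. mdist X ((x(i := t)) k) ((w(i := t)) k) < e"
      using w(2) by auto
  qed
  then show "\<exists>e>0. \<forall>w\<in>\<Pi>\<^sub>E k\<in>I. mspace X. (\<forall>k\<in>I. mdist X (x k) (w k) < e) \<longrightarrow>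
      w \<in> {x \<in> \<Pi>\<^sub>E k\<in>I. mspace X. x(i := t) \<in> V}"
    using e(1) by (intro exI[of _ e]) auto
qed auto

lemma openin_section_insert:
  assumes V: "box_open X (insert i I) V" and I: "i \<notin> I" and x: "x \<in> (\<Pi>\<^sub>E k\<in>I. mspace X)"
  shows "openin (mtopology_of X) {t \<in> mspace X. x(i := t) \<in> V}"
  unfolding openin_mtopology_of_iff
proof (intro conjI ballI)
  fix t assume t: "t \<in> {t \<in> mspace X. x(i := t) \<in> V}"
  then have xV: "x(i := t) \<in> V" by simp
  obtain e where e: "e > 0" "\<And>w. w \<in> (\<Pi>\<^sub>E k\<in>insert i I. mspace X) \<Longrightarrow>
      \<forall>k\<in>insert i I. mdist X ((x(i := t)) k) (w k) < e \<Longrightarrow> w \<in> V"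
    using box_openE[OF V xV] by auto
  have "x(i := u) \<in> V" if u: "u \<in> mspace X" "mdist X t u < e" for u
  proof (rule e(2))
    show "x(i := u) \<in> (\<Pi>\<^sub>E k\<in>insert i I. mspace X)"
      using x u by (auto simp: PiE_iff extensional_def)
    show "\<forall>k\<in>insert i I. mdist X ((x(i := t)) k) ((x(i := u)) k) < e"
    proof
      fix k assume k: "k \<in> insert i I"
      show "mdist X ((x(i := t)) k) ((x(i := u)) k) < e"
      proof (cases "k = i")
        case False
        then have "x k \<in> mspace X" using k x by auto
        then have "mdist X (x k) (x k) = 0" by (rule mdist_self)
        then show ?thesis using False e(1) by auto
      qed (use u in auto)
    qed
  qed
  then show "\<exists>e>0. \<forall>u\<in>mspace X. mdist X t u < e \<longrightarrow> u \<in> {t \<in> mspace X. x(i := t) \<in> V}"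
    using e(1) by (intro exI[of _ e]) auto
qed auto

text \<open>In the induction step the new coordinate is enlarged first, leading from \<open>U\<close> to \<open>V\<close>, and then all
  coordinates in \<open>I\<close> at once, leading from \<open>V\<close> into the full enlargement \<open>E\<close>.\<close>

lemma box_growth:
  assumes X: "metric_prob_space X \<mu>" and c: "0 \<le> c" and s: "1 \<le> s" "s \<le> 2"
    and gr: "open_growth X \<mu> (\<lambda>p. c * model_profile s p)" and I: "finite I"
  defines "P \<equiv> \<lambda>I. Pi\<^sub>M I (\<lambda>_. \<mu>)"
  shows "\<exists>K\<ge>0. \<forall>U r. box_open X I U \<longrightarrow> 0 < r \<longrightarrow>
     measure (P I) U + r * (c * model_profile s (measure (P I) U)) - K * r\<^sup>2
       \<le> measure (P I) (box_enlargement X I U r)"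
  using I
proof (induction I rule: finite_induct)
  case empty
  show ?case
  proof (intro exI[of _ 0] conjI allI impI)
    fix U :: "('b \<Rightarrow> 'a) set" and r :: real assume U: "box_open X {} U"
    then have E: "U \<subseteq> {\<lambda>x. undefined}" by (simp add: box_open_def)
    interpret prob_space "P {}"
      unfolding P_def by (intro prob_space_PiM) auto
    have sp: "space (P {}) = {\<lambda>x. undefined}" by (simp add: P_def space_PiM)
    have "U = {} \<or> U = space (P {})" using E sp by auto
    then have "model_profile s (measure (P {}) U) = 0" using prob_space by auto
    moreover have "box_enlargement X {} U r = U" using E by (auto simp: box_enlargement_def)
    ultimately show "measure (P {}) U + r * (c * model_profile s (measure (P {}) U)) - 0 * r\<^sup>2
       \<le> measure (P {}) (box_enlargement X {} U r)" by simp
  qed simp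
next
  case (insert i I)
  obtain K1 where K1: "0 \<le> K1" "\<And>U r. openin (mtopology_of X) U \<Longrightarrow> 0 < r \<Longrightarrow>
     measure \<mu> U + r * (c * model_profile s (measure \<mu> U)) - K1 * r\<^sup>2 \<le> measure \<mu> (enlargement X U r)"
    using gr unfolding open_growth_def by blast
  obtain K2 where K2: "0 \<le> K2" "\<And>U r. box_open X I U \<Longrightarrow> 0 < r \<Longrightarrow>
     measure (P I) U + r * (c * model_profile s (measure (P I) U)) - K2 * r\<^sup>2
       \<le> measure (P I) (box_enlargement X I U r)"
    using insert.IH by blast
  have \<mu>: "prob_space \<mu>" "space \<mu> = mspace X" using X by (auto simp: metric_prob_space_def)
  interpret M1: prob_space \<mu> by fact
  interpret M2: prob_space "P I" unfolding P_def by (intro prob_space_PiM \<mu>)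
  interpret pair_prob_space \<mu> "P I" ..
  let ?J = "insert i I"
  let ?W = "\<Pi>\<^sub>E k\<in>?J. mspace X"
  have XJ: "metric_prob_space (funspace ?J X) (P ?J)"
    unfolding P_def using insert.hyps by (intro metric_prob_space_power X) auto
  have spI: "space (P I) = (\<Pi>\<^sub>E k\<in>I. mspace X)" by (simp add: P_def space_PiM \<mu>)
  have spJ: "space (P ?J) = ?W" by (simp add: P_def space_PiM \<mu>)
  have box_sets: "U \<in> sets (P ?J)" if "box_open X ?J U" for U
    using openin_sets[OF XJ] openin_funspace[of ?J X U] that insert.hyps by auto
  define \<phi> where "\<phi> = (\<lambda>(t, x::'b \<Rightarrow> 'a). x(i := t))"
  have \<phi>_meas: "\<phi> \<in> measurable (\<mu> \<Otimes>\<^sub>M P I) (P ?J)"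
    unfolding \<phi>_def P_def case_prod_beta
    by (rule measurable_fun_upd[where J=I]) auto
  have distr: "distr (\<mu> \<Otimes>\<^sub>M P I) (P ?J) \<phi> = P ?J"
    unfolding \<phi>_def P_def by (rule distr_pair_PiM_eq_PiM) (use \<mu> in auto)
  \<comment> \<open>The identification of the power over \<open>insert i I\<close> with a product of two factors\<close>
  define pre where "pre = (\<lambda>A. \<phi> -` A \<inter> space (\<mu> \<Otimes>\<^sub>M P I))"
  have pre_meas: "measure (\<mu> \<Otimes>\<^sub>M P I) (pre A) = measure (P ?J) A"
    and pre_sets: "pre A \<in> sets (\<mu> \<Otimes>\<^sub>M P I)" if "A \<in> sets (P ?J)" for A
    using that measure_distr[OF \<phi>_meas that] measurable_sets[OF \<phi>_meas that]
    by (auto simp: pre_def distr)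
  have pre_iff: "(t, x) \<in> pre A \<longleftrightarrow> t \<in> mspace X \<and> x \<in> (\<Pi>\<^sub>E k\<in>I. mspace X) \<and> x(i := t) \<in> A" for t x A
    by (auto simp: pre_def \<phi>_def space_pair_measure spI \<mu>)
  show ?case
  proof (intro exI[of _ "K1 + K2 + 3 * c * c"] conjI allI impI)
    fix U and r :: real assume U: "box_open X ?J U" and r: "0 < r"
    have UW: "U \<subseteq> ?W" using U by (simp add: box_open_def)
    define V where "V = {z \<in> ?W. \<exists>y\<in>U. mdist X (z i) (y i) < r \<and> (\<forall>k\<in>I. y k = z k)}"
    define E where "E = box_enlargement X ?J U r"
    have V: "box_open X ?J V"
      unfolding V_def by (rule box_enlargement_insert_open[OF U insert.hyps])
    have "openin (mtopology_of (funspace ?J X)) (enlargement (funspace ?J X) U r)"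
      using insert.hyps UW by (intro openin_enlargement) (simp add: mspace_funspace_finite del: mspace_funspace)
    then have "box_open X ?J E"
      using insert.hyps UW by (simp add: openin_funspace enlargement_funspace E_def)
    then have ms: "U \<in> sets (P ?J)" "V \<in> sets (P ?J)" "E \<in> sets (P ?J)"
      using box_sets U V by auto
    have d0: "mdist X t t < r" if "t \<in> mspace X" for t
      using r mdist_self[OF that] by simp
    have UV: "U \<subseteq> V"
    proof
      fix z assume z: "z \<in> U"
      then have "z \<in> ?W" using UW by blast
      then show "z \<in> V" using z d0[OF PiE_mem[of z ?J "\<lambda>_. mspace X" i]]
        by (auto simp: V_def intro!: bexI[of _ z])
    qed
    have VE: "V \<subseteq> E"
    proof
      fix z assume "z \<in> V"
      then obtain y where y: "z \<in> ?W" "y \<in> U" "mdist X (z i) (y i) < r" "\<forall>k\<in>I. y k = z k"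
        by (auto simp: V_def)
      have "mdist X (z k) (y k) < r" if "k \<in> I" for k
        using y(4) that d0[OF PiE_mem[OF y(1)], of k] by simp
      then show "z \<in> E" using y by (auto simp: E_def box_enlargement_def intro!: bexI[of _ y])
    qed
    have "measure (\<mu> \<Otimes>\<^sub>M P I) (pre U) + r * (c * model_profile s (measure (\<mu> \<Otimes>\<^sub>M P I) (pre U)))
      - (K1 + K2 + 3 * c * c) * r\<^sup>2 \<le> measure (\<mu> \<Otimes>\<^sub>M P I) (pre E)"
    proof (rule two_step_growth[where ?S1.0 = "pre V"])
      show "pre U \<subseteq> pre V" "pre V \<subseteq> pre E" using UV VE by (auto simp: pre_def)
    next
      fix x assume x: "x \<in> space (P I)"
      let ?T = "{t \<in> mspace X. x(i := t) \<in> U}"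
      have 1: "(\<lambda>t. (t, x)) -` pre U = ?T"
        using x by (auto simp: pre_iff spI)
      have "enlargement X ?T r \<subseteq> (\<lambda>t. (t, x)) -` pre V"
      proof
        fix t assume "t \<in> enlargement X ?T r"
        then obtain u where u: "t \<in> mspace X" "u \<in> mspace X" "x(i := u) \<in> U" "mdist X t u < r"
          by (auto simp: enlargement_eq)
        then have "x(i := t) \<in> V"
          using x insert.hyps by (auto simp: V_def spI PiE_iff extensional_def intro!: bexI[of _ "x(i := u)"])
        then show "t \<in> (\<lambda>t. (t, x)) -` pre V" using x u by (auto simp: pre_iff spI)
      qed
      then have "measure \<mu> (enlargement X ?T r) \<le> measure \<mu> ((\<lambda>t. (t, x)) -` pre V)"
        by (intro M1.finite_measure_mono sets_Pair2[OF pre_sets] ms)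
      with K1(2)[OF openin_section_insert[OF U insert.hyps(2) x[unfolded spI]] r]
      show "measure \<mu> ((\<lambda>t. (t, x)) -` pre U) + r * (c * model_profile s (measure \<mu> ((\<lambda>t. (t, x)) -` pre U)))
         - K1 * r\<^sup>2 \<le> measure \<mu> ((\<lambda>t. (t, x)) -` pre V)"
        unfolding 1 by linarith
    next
      fix t assume "t \<in> space \<mu>"
      then have t: "t \<in> mspace X" by (simp add: \<mu>)
      let ?T = "{x \<in> \<Pi>\<^sub>E k\<in>I. mspace X. x(i := t) \<in> V}"
      have 1: "Pair t -` pre V = ?T"
        using t by (auto simp: pre_iff)
      have "box_enlargement X I ?T r \<subseteq> Pair t -` pre E"
      proof
        fix x assume "x \<in> box_enlargement X I ?T r"
        then obtain x' where x: "x \<in> (\<Pi>\<^sub>E k\<in>I. mspace X)" "x'(i := t) \<in> V" "\<forall>k\<in>I. mdist X (x k) (x' k) < r"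
          by (auto simp: box_enlargement_def)
        then obtain y where "y \<in> U" "mdist X ((x'(i := t)) i) (y i) < r" "\<forall>k\<in>I. y k = (x'(i := t)) k"
          unfolding V_def by blast
        then have y: "y \<in> U" "mdist X t (y i) < r" "\<forall>k\<in>I. y k = x' k"
          using insert.hyps by (simp, simp, metis fun_upd_other)
        have "x(i := t) \<in> ?W" using x t by (auto simp: PiE_iff extensional_def)
        then have "x(i := t) \<in> E"
          using x y insert.hyps by (auto simp: E_def box_enlargement_def intro!: bexI[of _ y])
        then show "x \<in> Pair t -` pre E" using x t by (auto simp: pre_iff)
      qed
      then have "measure (P I) (box_enlargement X I ?T r) \<le> measure (P I) (Pair t -` pre E)"
        by (intro M2.finite_measure_mono sets_Pair1[OF pre_sets] ms)
      with K2(2)[OF box_open_section_insert[OF V insert.hyps(2) t] r]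
      show "measure (P I) (Pair t -` pre V) + r * (c * model_profile s (measure (P I) (Pair t -` pre V)))
         - K2 * r\<^sup>2 \<le> measure (P I) (Pair t -` pre E)"
        unfolding 1 by linarith
    qed (use pre_sets ms c s r K1 K2 in auto)
    then show "measure (P ?J) U + r * (c * model_profile s (measure (P ?J) U)) - (K1 + K2 + 3 * c * c) * r\<^sup>2
       \<le> measure (P ?J) (box_enlargement X ?J U r)"
      using ms by (simp add: pre_meas E_def)
  qed (use K1 K2 c in auto)
qed

section \<open>Isoperimetric functions of powers\<close>

lemma borel_sets_of_compl:
  assumes "A \<in> borel_sets_of X"
  shows "mspace X - A \<in> borel_sets_of X"
  using assms unfolding borel_sets_of_def by (rule sigma_sets.Compl)

text \<open>The symmetry of \<open>L\<close> about \<open>1/2\<close> turns the bound for the complement of a set, that is for its inner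
  boundary measure, into the bound for the set.\<close>

lemma L_fun_le_isoperimetric_iff:
  assumes X: "metric_prob_space X \<mu>"
  shows "(\<forall>p\<in>{0..1}. L_fun c p \<le> isoperimetric X \<mu> p) \<longleftrightarrow>
    (\<forall>a\<in>{1/2..1}. \<forall>A\<in>borel_sets_of X.
      ennreal (c a * model_profile (1/a) (measure \<mu> A)) \<le> outer_boundary X \<mu> A)"
proof -
  interpret prob_space \<mu> using X by (simp add: metric_prob_space_def)
  have compl: "measure \<mu> (mspace X - A) = 1 - measure \<mu> A" if "A \<in> borel_sets_of X" for A
    using prob_compl[of A] that X by (auto simp: metric_prob_space_def)
  have "(\<forall>p\<in>{0..1}. L_fun c p \<le> isoperimetric X \<mu> p) \<longleftrightarrow>
    (\<forall>A\<in>borel_sets_of X. L_fun c (measure \<mu> A) \<le> min (outer_boundary X \<mu> A) (inner_boundary X \<mu> A))"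
    (is "?l \<longleftrightarrow> ?r")
  proof
    assume ?l
    moreover have "measure \<mu> A \<in> {0..1}" for A by simp
    ultimately show ?r
      unfolding isoperimetric_def le_INF_iff by blast
  next
    assume r: ?r
    show ?l
      unfolding isoperimetric_def
    proof (intro ballI INF_greatest)
      fix p A assume "A \<in> {A \<in> borel_sets_of X. measure \<mu> A = p}"
      then show "L_fun c p \<le> min (outer_boundary X \<mu> A) (inner_boundary X \<mu> A)" using r by auto
    qed
  qed
  also have "\<dots> \<longleftrightarrow> (\<forall>A\<in>borel_sets_of X. L_fun c (measure \<mu> A) \<le> outer_boundary X \<mu> A)"
  proof (intro iffI ballI)
    fix A assume *: "\<forall>A\<in>borel_sets_of X. L_fun c (measure \<mu> A) \<le> outer_boundary X \<mu> A"
      and A: "A \<in> borel_sets_of X"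
    have "L_fun c (measure \<mu> (mspace X - A)) = L_fun c (measure \<mu> A)"
      by (simp add: compl[OF A] L_fun_model_profile model_profile_reflect)
    then show "L_fun c (measure \<mu> A) \<le> min (outer_boundary X \<mu> A) (inner_boundary X \<mu> A)"
      using bspec[OF * A] bspec[OF * borel_sets_of_compl[OF A]]
      by (simp add: inner_boundary_def)
  qed simp
  also have "\<dots> \<longleftrightarrow> (\<forall>a\<in>{1/2..1}. \<forall>A\<in>borel_sets_of X.
      ennreal (c a * model_profile (1/a) (measure \<mu> A)) \<le> outer_boundary X \<mu> A)"
    unfolding L_fun_model_profile SUP_le_iff by blast
  finally show ?thesis .
qed

theorem L_fun_le_isoperimetric_power:
  fixes X :: "'a metric" and I :: "nat set"
  assumes X: "metric_prob_space X \<mu>" and c: "\<forall>a\<in>{1/2..1}. 0 \<le> c a"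
    and le: "\<forall>p\<in>{0..1}. L_fun c p \<le> isoperimetric X \<mu> p" and I: "finite I" "I \<noteq> {}"
  shows "\<forall>p\<in>{0..1}. L_fun c p \<le> isoperimetric (funspace I X) (Pi\<^sub>M I (\<lambda>_. \<mu>)) p"
proof -
  let ?Y = "funspace I X" and ?P = "Pi\<^sub>M I (\<lambda>_. \<mu>)"
  have Y: "metric_prob_space ?Y ?P" by (rule metric_prob_space_power[OF X I])
  have bX: "\<forall>a\<in>{1/2..1}. \<forall>A\<in>borel_sets_of X.
      ennreal (c a * model_profile (1/a) (measure \<mu> A)) \<le> outer_boundary X \<mu> A"
    using le unfolding L_fun_le_isoperimetric_iff[OF X] .
  show ?thesis
    unfolding L_fun_le_isoperimetric_iff[OF Y]
  proof (intro ballI)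
    fix a A assume a: "a \<in> {1/2..1::real}" and A: "A \<in> borel_sets_of ?Y"
    have s: "1 \<le> 1/a" "1/a \<le> 2" and ca: "0 \<le> c a" using a c by (auto simp: field_simps)
    have "open_growth X \<mu> (\<lambda>p. c a * model_profile (1/a) p)"
      using bX a by (intro open_growth_of_boundary[OF X ca s]) auto
    from box_growth[OF X ca s this I(1)] obtain K where K: "0 \<le> K"
      "\<And>U r. box_open X I U \<Longrightarrow> 0 < r \<Longrightarrow>
       measure ?P U + r * (c a * model_profile (1/a) (measure ?P U)) - K * r\<^sup>2
       \<le> measure ?P (box_enlargement X I U r)" by blast
    have "open_growth ?Y ?P (\<lambda>p. c a * model_profile (1/a) p)"
      unfolding open_growth_def openin_funspace[OF I]
    proof (intro exI[of _ K] conjI allI impI)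
      fix U and r :: real assume U: "box_open X I U" "0 < r"
      then have "enlargement ?Y U r = box_enlargement X I U r"
        by (intro enlargement_funspace I) (simp add: box_open_def)
      then show "measure ?P U + r * (c a * model_profile (1/a) (measure ?P U)) - K * r\<^sup>2
        \<le> measure ?P (enlargement ?Y U r)" using K(2)[OF U] by simp
    qed (rule K)
    then show "ennreal (c a * model_profile (1/a) (measure ?P A)) \<le> outer_boundary ?Y ?P A"
      by (rule boundary_of_open_growth[OF Y ca s _ A])
  qed
qed

text \<open>Enlarging a cylinder for the supremum distance enlarges its base by the same amount.\<close>

lemma outer_boundary_cylinder:
  assumes X: "metric_prob_space X \<mu>" and A: "A \<in> borel_sets_of X" and I: "finite I" "i \<in> I"
  defines "C \<equiv> \<lambda>A. {x \<in> \<Pi>\<^sub>E i\<in>I. mspace X. x i \<in> A}"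
  shows "C A \<in> borel_sets_of (funspace I X)"
    and "measure (Pi\<^sub>M I (\<lambda>_. \<mu>)) (C A) = measure \<mu> A"
    and "outer_boundary (funspace I X) (Pi\<^sub>M I (\<lambda>_. \<mu>)) (C A) = outer_boundary X \<mu> A"
    and "inner_boundary (funspace I X) (Pi\<^sub>M I (\<lambda>_. \<mu>)) (C A) = inner_boundary X \<mu> A"
proof -
  let ?Y = "funspace I X" and ?P = "Pi\<^sub>M I (\<lambda>_. \<mu>)"
  have ne: "I \<noteq> {}" using I by auto
  have Y: "metric_prob_space ?Y ?P" by (rule metric_prob_space_power[OF X I(1) ne])
  have \<mu>: "prob_space \<mu>" "space \<mu> = mspace X" "sets \<mu> = borel_sets_of X"
    using X by (auto simp: metric_prob_space_def)
  have Yb: "sets ?P = borel_sets_of ?Y" using Y by (simp add: metric_prob_space_def)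
  have spP: "space ?P = (\<Pi>\<^sub>E i\<in>I. mspace X)" by (simp add: space_PiM \<mu>)
  have comp: "(\<lambda>x. x i) \<in> measurable ?P \<mu>" using I by measurable
  have C_eq: "C B = (\<lambda>x. x i) -` B \<inter> space ?P" for B by (auto simp: C_def spP)
  have Cs: "C B \<in> borel_sets_of ?Y" and Cm: "measure ?P (C B) = measure \<mu> B"
    if "B \<in> borel_sets_of X" for B
  proof -
    have B: "B \<in> sets \<mu>" using that \<mu> by simp
    show "C B \<in> borel_sets_of ?Y" unfolding C_eq Yb[symmetric] by (rule measurable_sets[OF comp B])
    have "measure ?P (C B) = measure (distr ?P \<mu> (\<lambda>x. x i)) B"
      unfolding C_eq by (rule measure_distr[OF comp B, symmetric])
    also have "distr ?P \<mu> (\<lambda>x. x i) = \<mu>"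
      using distr_PiM_component[of I "\<lambda>_. \<mu>" i] \<mu> I by simp
    finally show "measure ?P (C B) = measure \<mu> B" .
  qed
  show "C A \<in> borel_sets_of ?Y" "measure ?P (C A) = measure \<mu> A" using Cs Cm A by auto
  have outer: "outer_boundary ?Y ?P (C B) = outer_boundary X \<mu> B" if B: "B \<in> borel_sets_of X" for B
  proof -
    have BX: "B \<subseteq> mspace X" by (rule borel_sets_subset[OF B])
    have *: "measure ?P (enlargement ?Y (C B) r) = measure \<mu> (enlargement X B r)" if r: "0 < r" for r
    proof -
      have "enlargement ?Y (C B) r = box_enlargement X I (C B) r"
        using I ne by (intro enlargement_funspace) (auto simp: C_def)
      also have "\<dots> = C (enlargement X B r)"
      proof (intro subset_antisym subsetI)
        fix x assume "x \<in> C (enlargement X B r)"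
        then obtain t where x: "x \<in> (\<Pi>\<^sub>E i\<in>I. mspace X)" and t: "t \<in> B" "mdist X (x i) t < r"
          by (auto simp: C_def enlargement_eq)
        have "x(i := t) \<in> C B" using x t BX I by (auto simp: C_def PiE_iff extensional_def)
        moreover have "mdist X (x k) ((x(i := t)) k) < r" if "k \<in> I" for k
        proof (cases "k = i")
          case False
          have "x k \<in> mspace X" by (rule PiE_mem[OF x that])
          then have "mdist X (x k) (x k) = 0" by (rule mdist_self)
          then show ?thesis using r False by auto
        qed (use t in auto)
        ultimately show "x \<in> box_enlargement X I (C B) r"
          using x by (auto simp: box_enlargement_def intro!: bexI[of _ "x(i := t)"])
      next
        fix x assume "x \<in> box_enlargement X I (C B) r"
        then obtain y where y: "x \<in> (\<Pi>\<^sub>E i\<in>I. mspace X)" "y \<in> C B" "\<forall>i\<in>I. mdist X (x i) (y i) < r"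
          unfolding box_enlargement_def by blast
        then show "x \<in> C (enlargement X B r)"
          using I PiE_mem[OF y(1)] unfolding C_def enlargement_eq by blast
      qed
      finally have "enlargement ?Y (C B) r = C (enlargement X B r)" .
      moreover have "enlargement X B r \<in> borel_sets_of X"
        using openin_sets[OF X openin_enlargement[OF BX]] \<mu> by simp
      ultimately show ?thesis using Cm by simp
    qed
    show ?thesis
      unfolding outer_boundary_def
      by (intro Liminf_eq eventually_mono[OF eventually_at_right_less]) (simp add: * Cm[OF B])
  qed
  show "outer_boundary ?Y ?P (C A) = outer_boundary X \<mu> A" by (rule outer[OF A])
  have "mspace ?Y - C A = C (mspace X - A)"
    using I by (auto simp: C_def mspace_funspace_finite simp del: mspace_funspace)
  then show "inner_boundary ?Y ?P (C A) = inner_boundary X \<mu> A"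
    unfolding inner_boundary_def using outer[OF borel_sets_of_compl[OF A]] by simp
qed

lemma isoperimetric_power_le:
  assumes X: "metric_prob_space X \<mu>" and I: "finite I" "I \<noteq> {}"
  shows "isoperimetric (funspace I X) (Pi\<^sub>M I (\<lambda>_. \<mu>)) p \<le> isoperimetric X \<mu> p"
proof -
  obtain i where i: "i \<in> I" using I by auto
  show ?thesis
    unfolding isoperimetric_def
  proof (rule INF_mono, goal_cases)
    case (1 A)
    then have A: "A \<in> borel_sets_of X" "measure \<mu> A = p" by auto
    show ?case
      using outer_boundary_cylinder[OF X A(1) I(1) i] A(2)
      by (intro bexI[of _ "{x \<in> \<Pi>\<^sub>E i\<in>I. mspace X. x i \<in> A}"]) simp_all
  qed
qed

text \<open>Cylinders bound the isoperimetric function of a power from above by that of the factor, and the lower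
  bound for powers meets it.\<close>

lemma profile_inf_eq_L_fun:
  fixes X :: "'a metric" and n :: nat
  assumes X: "metric_prob_space X \<mu>" and c: "\<forall>a\<in>{1/2..1}. 0 \<le> c a"
    and eq: "\<forall>p\<in>{0..1}. isoperimetric X \<mu> p = L_fun c p" and n: "1 \<le> n" and p: "p \<in> {0..1}"
  shows "isoperimetric (funspace {..<n} X) (Pi\<^sub>M {..<n} (\<lambda>_. \<mu>)) p = L_fun c p"
    and "profile_inf X \<mu> p = L_fun c p"
proof -
  have *: "isoperimetric (funspace {..<n} X) (Pi\<^sub>M {..<n} (\<lambda>_. \<mu>)) p = L_fun c p" if n: "1 \<le> n" for n :: nat
  proof (rule antisym)
    have "0 \<in> {..<n}" using n by simp
    then have ne: "{..<n} \<noteq> {}" by blast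
    show "isoperimetric (funspace {..<n} X) (Pi\<^sub>M {..<n} (\<lambda>_. \<mu>)) p \<le> L_fun c p"
      using isoperimetric_power_le[OF X, of "{..<n}" p] eq p ne by simp
    show "L_fun c p \<le> isoperimetric (funspace {..<n} X) (Pi\<^sub>M {..<n} (\<lambda>_. \<mu>)) p"
      using L_fun_le_isoperimetric_power[OF X c _ _ ne] eq p by simp
  qed
  show "isoperimetric (funspace {..<n} X) (Pi\<^sub>M {..<n} (\<lambda>_. \<mu>)) p = L_fun c p" by (rule *[OF n])
  show "profile_inf X \<mu> p = L_fun c p"
    unfolding profile_inf_def using * by (simp add: INF_eq_const)
qed

section \<open>Symmetric profiles with the scaling property\<close>

text \<open>The role of \<open>l\<close> is played by \<open>L\<close>, as a real function, when it is positive and finite on \<open>{0<..<1}\<close>.\<close>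

locale symmetric_profile =
  fixes l :: "real \<Rightarrow> real"
  assumes l_0: "l 0 = 0"
    and l_pos: "0 < p \<Longrightarrow> p < 1 \<Longrightarrow> 0 < l p"
    and l_reflect: "0 \<le> p \<Longrightarrow> p \<le> 1 \<Longrightarrow> l (1 - p) = l p"
    and l_scale: "0 \<le> p \<Longrightarrow> p \<le> 1 \<Longrightarrow> 0 \<le> t \<Longrightarrow> t \<le> 1 \<Longrightarrow> t * l p \<le> l (t * p)"
begin

lemma l_nonneg: "0 \<le> p \<Longrightarrow> p \<le> 1 \<Longrightarrow> 0 \<le> l p"
  using l_pos[of p] l_0 l_reflect[of 0] by (cases "p = 0 \<or> p = 1") auto

lemma l_subadditive:
  assumes "0 \<le> p" "0 \<le> q" "p + q \<le> 1"
  shows "l (p + q) \<le> l p + l q"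
proof (cases "p + q = 0")
  case False
  then have pq: "0 < p + q" using assms by linarith
  have 1: "p / (p + q) * l (p + q) \<le> l p" and 2: "q / (p + q) * l (p + q) \<le> l q"
    using l_scale[of "p + q" "p / (p + q)"] l_scale[of "p + q" "q / (p + q)"] assms pq by auto
  have "l (p + q) = (p / (p + q) + q / (p + q)) * l (p + q)"
    using pq by (simp add: add_divide_distrib[symmetric])
  then show ?thesis using 1 2 by (simp add: distrib_right)
qed (use assms l_0 in \<open>auto simp: add_nonneg_eq_0_iff\<close>)

lemma l_sum_le:
  assumes "finite F" "\<And>T. T \<in> F \<Longrightarrow> 0 \<le> f T" "sum f F \<le> 1"
  shows "l (sum f F) \<le> (\<Sum>T\<in>F. l (f T))"
  using assms
proof (induction F rule: finite_induct)
  case (insert T F)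
  have "0 \<le> f T" "0 \<le> sum f F" using insert.prems by (auto intro: sum_nonneg)
  moreover have "f T + sum f F \<le> 1" using insert by simp
  ultimately have "l (f T + sum f F) \<le> l (f T) + l (sum f F)" "sum f F \<le> 1"
    by (auto intro: l_subadditive)
  then show ?case using insert by fastforce
qed (simp add: l_0)

text \<open>Scaling towards \<open>0\<close> compares \<open>l\<close> at \<open>p \<le> q\<close>; scaling towards \<open>1\<close>, by reflection, compares it at
  \<open>p \<ge> q\<close>.  The factor tends to \<open>1\<close> as \<open>p\<close> and \<open>q\<close> approach each other, hence \<open>l\<close> is continuous.\<close>

lemma l_compare:
  assumes "0 < p" "p < 1" "0 < q" "q < 1"
  shows "min (p / q) ((1 - p) / (1 - q)) * l q \<le> l p"
proof -
  have lq: "0 \<le> l q" using assms l_nonneg by auto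
  show ?thesis
  proof (cases "p \<le> q")
    case True
    have "min (p / q) ((1 - p) / (1 - q)) * l q \<le> p / q * l q"
      by (intro mult_right_mono lq) auto
    also have "\<dots> \<le> l p" using l_scale[of q "p / q"] assms True by simp
    finally show ?thesis .
  next
    case False
    have "min (p / q) ((1 - p) / (1 - q)) * l q \<le> (1 - p) / (1 - q) * l q"
      by (intro mult_right_mono lq) auto
    also have "\<dots> \<le> l (1 - p)"
      using l_scale[of "1 - q" "(1 - p) / (1 - q)"] l_reflect[of q] assms False by simp
    finally show ?thesis using l_reflect[of p] assms by simp
  qed
qed

lemma isCont_l:
  assumes "0 < p" "p < 1"
  shows "isCont l p"
  unfolding isCont_def
proof (rule tendsto_sandwich)
  let ?m = "\<lambda>p q. min (p / q) ((1 - p) / (1 - q)) :: real"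
  have ev: "eventually (\<lambda>x. x \<in> {0<..<1}) (at p)"
    using assms by (intro eventually_at_in_open') auto
  show "eventually (\<lambda>x. ?m x p * l p \<le> l x) (at p)"
    using ev by eventually_elim (use assms in \<open>auto intro!: l_compare\<close>)
  show "eventually (\<lambda>x. l x \<le> l p / ?m p x) (at p)"
    using ev
  proof eventually_elim
    case (elim x)
    then have "0 < ?m p x" using assms by (auto simp: min_def)
    then show ?case using l_compare[of p x] elim assms by (auto simp: field_simps)
  qed
  have "((\<lambda>x. ?m x p * l p) \<longlongrightarrow> ?m p p * l p) (at p)"
    using assms by (intro tendsto_intros) auto
  then show "((\<lambda>x. ?m x p * l p) \<longlongrightarrow> l p) (at p)" using assms by simp
  have "((\<lambda>x. l p / ?m p x) \<longlongrightarrow> l p / ?m p p) (at p)"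
    using assms by (intro tendsto_intros) auto
  then show "((\<lambda>x. l p / ?m p x) \<longlongrightarrow> l p) (at p)" using assms by simp
qed

text \<open>An antiderivative of \<open>1/l\<close> becomes odd about \<open>1/2\<close> by antisymmetrisation, which keeps the derivative as
  \<open>l\<close> is symmetric.\<close>

lemma odd_quantile_exists:
  "\<exists>G. (\<forall>p\<in>{0<..<1}. (G has_real_derivative 1 / l p) (at p)) \<and> (\<forall>p. G (1 - p) = - G p)"
proof -
  have "\<exists>F. \<forall>x::real. ereal 0 < x \<longrightarrow> x < ereal 1 \<longrightarrow> (F has_vector_derivative 1 / l x) (at x)"
  proof (rule einterval_antiderivative)
    fix x assume "ereal 0 < ereal x" "ereal x < ereal 1"
    then show "isCont (\<lambda>x. 1 / l x) x"
      using isCont_l[of x] l_pos[of x] by (auto intro!: continuous_intros)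
  qed simp
  then obtain F where F: "\<And>x::real. 0 < x \<Longrightarrow> x < 1 \<Longrightarrow> (F has_real_derivative 1 / l x) (at x)"
    by (auto simp: has_real_derivative_iff_has_vector_derivative)
  define G where "G = (\<lambda>p. (F p - F (1 - p)) / 2)"
  have "(G has_real_derivative 1 / l p) (at p)" if "0 < p" "p < 1" for p
  proof -
    have 1: "((\<lambda>p. F (1 - p)) has_real_derivative 1 / l (1 - p) * (- 1)) (at p)"
      using that by (intro DERIV_chain2[OF F]) (auto intro!: derivative_eq_intros)
    have "(G has_real_derivative (1 / l p - 1 / l (1 - p) * (- 1)) / 2) (at p)"
      unfolding G_def by (intro DERIV_cdivide DERIV_diff F 1 that)
    then show ?thesis using l_reflect[of p] that by simp
  qed
  moreover have "G (1 - p) = - G p" for p by (simp add: G_def field_simps)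
  ultimately show ?thesis by (intro exI[of _ G]) auto
qed

end

section \<open>The measure with a given quantile function\<close>

locale odd_quantile = symmetric_profile +
  fixes G :: "real \<Rightarrow> real"
  assumes G_deriv: "0 < p \<Longrightarrow> p < 1 \<Longrightarrow> (G has_real_derivative 1 / l p) (at p)"
    and G_odd: "G (1 - p) = - G p"
begin

definition law :: "real measure" where
  "law = distr (restrict_space lborel {0<..<1}) borel G"

lemma G_strict_mono:
  assumes "0 < p" "p < q" "q < 1"
  shows "G p < G q"
proof (rule DERIV_pos_imp_increasing[OF assms(2)])
  fix x assume "p \<le> x" "x \<le> q"
  then show "\<exists>y. (G has_real_derivative y) (at x) \<and> 0 < y"
    using G_deriv[of x] l_pos[of x] assms by (intro exI[of _ "1 / l x"]) auto
qed

lemma G_less_iff: "p \<in> {0<..<1} \<Longrightarrow> q \<in> {0<..<1} \<Longrightarrow> G p < G q \<longleftrightarrow> p < q"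
  using G_strict_mono[of p q] G_strict_mono[of q p] by (cases p q rule: linorder_cases) auto

lemma G_le_iff: "p \<in> {0<..<1} \<Longrightarrow> q \<in> {0<..<1} \<Longrightarrow> G p \<le> G q \<longleftrightarrow> p \<le> q"
  using G_less_iff[of q p] by (simp add: not_less[symmetric] del: not_less)

lemma isCont_G: "0 < p \<Longrightarrow> p < 1 \<Longrightarrow> isCont G p"
  using G_deriv DERIV_isCont by blast

lemma G_measurable: "G \<in> borel_measurable (restrict_space lborel {0<..<1})"
proof -
  have "continuous_on {0<..<1} G"
    by (intro continuous_at_imp_continuous_on ballI isCont_G) auto
  then have "G \<in> borel_measurable (restrict_space borel {0<..<1})"
    by (rule borel_measurable_continuous_on_restrict)
  moreover have "sets (restrict_space borel {0<..<1}) = sets (restrict_space lborel {0<..<1::real})"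
    by (simp add: sets_restrict_space)
  ultimately show ?thesis by (simp cong: measurable_cong_sets)
qed

lemma sets_law [measurable_cong, simp]: "sets law = sets borel"
  by (simp add: law_def)

lemma space_law [simp]: "space law = UNIV"
  by (simp add: law_def)

lemma vimage_G: "G -` A \<inter> space (restrict_space lborel {0<..<1}) = {p\<in>{0<..<1}. G p \<in> A}"
  by (auto simp: space_restrict_space)

lemma vimage_G_sets: "A \<in> sets borel \<Longrightarrow> {p\<in>{0<..<1}. G p \<in> A} \<in> sets lborel"
  using measurable_sets[OF G_measurable, of A] unfolding vimage_G
  by (simp add: sets_restrict_space_iff)

lemma emeasure_law:
  assumes A: "A \<in> sets borel"
  shows "emeasure law A = emeasure lborel {p\<in>{0<..<1}. G p \<in> A}"
proof -
  have "emeasure law A = emeasure (restrict_space lborel {0<..<1}) {p\<in>{0<..<1}. G p \<in> A}"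
    unfolding law_def vimage_G[symmetric] by (rule emeasure_distr[OF G_measurable A])
  also have "\<dots> = emeasure lborel {p\<in>{0<..<1}. G p \<in> A}"
    by (rule emeasure_restrict_space) auto
  finally show ?thesis .
qed

lemma measure_law: "A \<in> sets borel \<Longrightarrow> measure law A = measure lborel {p\<in>{0<..<1}. G p \<in> A}"
  by (simp add: measure_def emeasure_law)

sublocale law: prob_space law
proof
  have "{p\<in>{0<..<1}. G p \<in> UNIV} = {0<..<1::real}" by auto
  then show "emeasure law (space law) = 1" by (simp add: emeasure_law)
qed

lemma even_law: "even_measure law"
  unfolding even_measure_def
proof (rule measure_eqI)
  fix A assume "A \<in> sets (distr law borel uminus)"
  then have A: "A \<in> sets borel" by simp
  have "uminus \<in> measurable law borel" by (simp add: measurable_cong_sets[OF sets_law refl])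
  then have "emeasure (distr law borel uminus) A = emeasure law (uminus -` A)"
    using A by (simp add: emeasure_distr)
  also have "uminus -` A \<in> sets borel"
    using measurable_sets[OF borel_measurable_uminus[of "\<lambda>x. x::real" borel] A] by simp
  then have "emeasure law (uminus -` A) = emeasure lborel {p\<in>{0<..<1}. - G p \<in> A}"
    by (simp add: emeasure_law)
  also have "{p\<in>{0<..<1}. - G p \<in> A} = (\<lambda>p. 1 + (- 1) * p) -` {p\<in>{0<..<1}. G p \<in> A} \<inter> space lborel"
    by (auto simp: G_odd)
  also have "emeasure lborel \<dots> = emeasure (distr lborel borel (\<lambda>p. 1 + (- 1) * p)) {p\<in>{0<..<1}. G p \<in> A}"
    using vimage_G_sets[OF A] by (intro emeasure_distr[symmetric]) auto
  also have "distr lborel borel (\<lambda>p. 1 + (- 1) * p) = (lborel :: real measure)"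
    using lborel_real_affine[of "- 1" 1] by (simp add: density_1 one_ennreal_def[symmetric])
  finally show "emeasure (distr law borel uminus) A = emeasure law A"
    by (simp add: emeasure_law[OF A])
qed simp

lemma measure_law_reflect:
  assumes "A \<in> sets borel"
  shows "measure law (uminus -` A) = measure law A"
proof -
  have "uminus \<in> measurable law borel" by (simp add: measurable_cong_sets[OF sets_law refl])
  then have "measure (distr law borel uminus) A = measure law (uminus -` A)"
    using assms by (simp add: measure_distr)
  then show ?thesis using even_law by (simp add: even_measure_def)
qed

lemma measure_law_atMost:
  assumes p: "p \<in> {0<..<1}"
  shows "measure law {..G p} = p"
proof -
  have "{q\<in>{0<..<1}. G q \<in> {..G p}} = {0<..p}" using p by (auto simp: G_le_iff)
  then show ?thesis using p by (simp add: measure_law)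
qed

text \<open>Write \<open>p\<close> for the measure of \<open>{..x}\<close>.  If \<open>x\<close> differed from \<open>G p\<close>, continuity would give
  \<open>q \<noteq> p\<close> with \<open>G q\<close> strictly between them.  The half-lines ending at \<open>G q\<close> and at \<open>x\<close>, of measures \<open>q\<close>
  and \<open>p\<close>, would then be nested in the wrong order.\<close>

lemma G_of_measure_atMost:
  assumes p: "measure law {..x} \<in> {0<..<1}"
  shows "G (measure law {..x}) = x"
proof (rule ccontr)
  let ?p = "measure law {..x}"
  assume ne: "G ?p \<noteq> x"
  have lim: "(G \<longlongrightarrow> G ?p) (at ?p)" using isCont_G p by (auto simp: isCont_def)
  have ev: "eventually (\<lambda>q. q \<in> {0<..<1}) (at ?p)" using p by (intro eventually_at_in_open') auto
  show False
  proof (cases "G ?p < x")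
    case True
    have "eventually (\<lambda>q. G q < x \<and> q \<in> {0<..<1}) (at_right ?p)"
      using order_tendstoD(2)[OF lim True] ev
      by (auto intro: eventually_conj simp: eventually_at_split)
    moreover have "eventually (\<lambda>q. q > ?p) (at_right ?p)" by (rule eventually_at_right_less)
    ultimately have "eventually (\<lambda>q. G q < x \<and> q \<in> {0<..<1} \<and> q > ?p) (at_right ?p)"
      by eventually_elim auto
    then obtain q where q: "G q < x" "q \<in> {0<..<1}" "q > ?p" by (auto dest!: eventually_happens)
    have "measure law {..G q} \<le> ?p" using q by (intro law.finite_measure_mono) auto
    then show False using measure_law_atMost q by simp
  next
    case False
    then have "x < G ?p" using ne by simp
    then have "eventually (\<lambda>q. x < G q \<and> q \<in> {0<..<1}) (at_left ?p)"
      using order_tendstoD(1)[OF lim] ev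
      by (auto intro: eventually_conj simp: eventually_at_split)
    moreover have "eventually (\<lambda>q. q < ?p) (at_left ?p)" by (simp add: eventually_at_filter)
    ultimately have "eventually (\<lambda>q. x < G q \<and> q \<in> {0<..<1} \<and> q < ?p) (at_left ?p)"
      by eventually_elim auto
    then obtain q where q: "x < G q" "q \<in> {0<..<1}" "q < ?p" by (auto dest!: eventually_happens)
    have "?p \<le> measure law {..G q}" using q by (intro law.finite_measure_mono) auto
    then show False using measure_law_atMost q by simp
  qed
qed

lemma G_increment_less:
  assumes p: "p \<in> {0<..<1}" and k: "0 < k" "k < l p"
  shows "eventually (\<lambda>r. p + k * r < 1 \<and> G (p + k * r) < G p + r) (at_right 0)"
proof -
  have "((\<lambda>h. (G (p + h) - G p) / h) \<longlongrightarrow> 1 / l p) (at 0)"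
    using G_deriv[of p] p by (simp add: DERIV_def)
  moreover have "1 / l p < 1 / k" using k by (intro divide_strict_left_mono) auto
  ultimately have "eventually (\<lambda>h. (G (p + h) - G p) / h < 1 / k) (at 0)"
    by (rule order_tendstoD(2))
  then have 1: "eventually (\<lambda>h. (G (p + h) - G p) / h < 1 / k) (at_right 0)"
    by (simp add: eventually_at_split)
  have 2: "filterlim (\<lambda>r. k * r) (at_right 0) (at_right 0)"
    using filterlim_times_pos[of "\<lambda>x. x" 0 "at_right 0" k "k * 0"] k by (simp add: filterlim_ident mult.commute)
  have "eventually (\<lambda>r. (G (p + k * r) - G p) / (k * r) < 1 / k) (at_right 0)"
    using eventually_compose_filterlim[OF 1 2] by simp
  moreover have "eventually (\<lambda>r. r \<in> {0<..<(1 - p) / k}) (at_right 0)"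
    using p k by (intro eventually_at_right_real) auto
  ultimately show ?thesis
  proof eventually_elim
    case (elim r)
    then have "0 < k * r" using k by simp
    with elim have "G (p + k * r) - G p < 1 / k * (k * r)" by (simp only: pos_divide_less_eq)
    moreover have "k * r < 1 - p" using elim k by (simp add: field_simps)
    ultimately show ?case using k by simp
  qed
qed

lemma G_increment_greater:
  assumes p: "p \<in> {0<..<1}" and k: "l p < k"
  shows "eventually (\<lambda>r. p + k * r < 1 \<and> G p + r < G (p + k * r)) (at_right 0)"
proof -
  have k0: "0 < k" using k l_pos[of p] p by auto
  have "((\<lambda>h. (G (p + h) - G p) / h) \<longlongrightarrow> 1 / l p) (at 0)"
    using G_deriv[of p] p by (simp add: DERIV_def)
  moreover have "1 / k < 1 / l p" using k l_pos[of p] p by (intro divide_strict_left_mono) auto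
  ultimately have "eventually (\<lambda>h. 1 / k < (G (p + h) - G p) / h) (at 0)"
    by (rule order_tendstoD(1))
  then have 1: "eventually (\<lambda>h. 1 / k < (G (p + h) - G p) / h) (at_right 0)"
    by (simp add: eventually_at_split)
  have 2: "filterlim (\<lambda>r. k * r) (at_right 0) (at_right 0)"
    using filterlim_times_pos[of "\<lambda>x. x" 0 "at_right 0" k "k * 0"] k0 by (simp add: filterlim_ident mult.commute)
  have "eventually (\<lambda>r. 1 / k < (G (p + k * r) - G p) / (k * r)) (at_right 0)"
    using eventually_compose_filterlim[OF 1 2] by simp
  moreover have "eventually (\<lambda>r. r \<in> {0<..<(1 - p) / k}) (at_right 0)"
    using p k0 by (intro eventually_at_right_real) auto
  ultimately show ?thesis
  proof eventually_elim
    case (elim r)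
    then have "0 < k * r" using k0 by simp
    with elim have "1 / k * (k * r) < G (p + k * r) - G p" by (simp only: pos_less_divide_eq)
    moreover have "k * r < 1 - p" using elim k0 by (simp add: field_simps)
    ultimately show ?case using k0 by simp
  qed
qed

lemma eventually_nonpos_mult_le_measure:
  assumes "k \<le> 0"
  shows "eventually (\<lambda>r. k * r \<le> measure law (S r)) (at_right 0)"
  using eventually_at_right_less[of "0::real"]
proof eventually_elim
  case (elim r)
  then have "k * r \<le> 0" using assms by (simp add: mult_le_0_iff)
  then show ?case using measure_nonneg by (rule order_trans)
qed

text \<open>Beyond the point \<open>G p\<close> the law has at least mass \<open>k r\<close> within distance \<open>r\<close>: the interval from
  \<open>p\<close> to \<open>p + k r\<close> is mapped into it.\<close>

lemma right_gain:
  assumes p: "p \<in> {0<..<1}" and k: "k < l p"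
  shows "eventually (\<lambda>r. k * r \<le> measure law {G p<..<G p + r}) (at_right 0)"
proof (cases "0 < k")
  case True
  from G_increment_less[OF p True k] eventually_at_right_less[of 0]
  show ?thesis
  proof eventually_elim
    case (elim r)
    have "{p<..<p + k * r} \<subseteq> {q\<in>{0<..<1}. G q \<in> {G p<..<G p + r}}"
    proof
      fix q assume q: "q \<in> {p<..<p + k * r}"
      then have "G p < G q" "G q < G (p + k * r)" using elim p by (auto intro: G_strict_mono)
      then show "q \<in> {q\<in>{0<..<1}. G q \<in> {G p<..<G p + r}}" using q elim p by auto
    qed
    then have "emeasure lborel {p<..<p + k * r} \<le> emeasure law {G p<..<G p + r}"
      unfolding emeasure_law[OF borel_open[OF open_greaterThanLessThan]]
      by (intro emeasure_mono vimage_G_sets) auto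
    then show ?case using elim True by (simp add: law.emeasure_eq_measure)
  qed
next
  case False
  then show ?thesis by (intro eventually_nonpos_mult_le_measure) simp
qed

lemma left_gain:
  assumes p: "p \<in> {0<..<1}" and k: "k < l p"
  shows "eventually (\<lambda>r. k * r \<le> measure law {G p - r<..<G p}) (at_right 0)"
proof -
  have "{G p - r<..<G p} = uminus -` {G (1 - p)<..<G (1 - p) + r}" for r
    by (auto simp: G_odd)
  then have "measure law {G p - r<..<G p} = measure law {G (1 - p)<..<G (1 - p) + r}" for r
    using measure_law_reflect[of "{G (1 - p)<..<G (1 - p) + r}"] by simp
  then show ?thesis
    using right_gain[of "1 - p" k] p k l_reflect[of p] by simp
qed

end

section \<open>Isoperimetry on the line\<close>

lemma borel_sets_of_euclidean: "borel_sets_of (euclidean_metric :: real metric) = sets borel"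
  by (simp add: borel_sets_of_def borel_def)

lemma metric_prob_space_euclidean:
  fixes \<nu> :: "real measure"
  assumes "prob_space \<nu>" "sets \<nu> = sets borel"
  shows "metric_prob_space euclidean_metric \<nu>"
proof -
  have "separable_space (mtopology_of (euclidean_metric :: real metric))"
    unfolding separable_mtopology_of_iff
  proof -
    obtain D :: "real set" where D: "countable D" "\<And>X. open X \<Longrightarrow> X \<noteq> {} \<Longrightarrow> \<exists>d\<in>D. d \<in> X"
      using countable_dense_exists by blast
    have "\<exists>y\<in>D. dist x y < r" if "r > 0" for x r
      using D(2)[of "ball x r"] that by (auto simp: mem_ball)
    then show "\<exists>C. countable C \<and> C \<subseteq> mspace euclidean_metric \<and>
      (\<forall>x\<in>mspace (euclidean_metric :: real metric). \<forall>r>0. \<exists>y\<in>C. mdist euclidean_metric x y < r)"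
      using D(1) by (intro exI[of _ D]) auto
  qed
  moreover have "sets \<nu> = borel_sets_of euclidean_metric"
    by (simp add: assms borel_sets_of_euclidean)
  moreover have "space \<nu> = UNIV" using sets_eq_imp_space_eq[OF assms(2)] by simp
  ultimately show ?thesis using assms by (simp add: metric_prob_space_def)
qed

lemma enlargement_euclidean: "enlargement euclidean_metric A r = {x. \<exists>y\<in>A. dist x y < r}"
  by (simp add: enlargement_eq)

lemma closure_subset_enlargement:
  fixes A :: "real set"
  assumes "z \<in> closure A" "dist x z < r"
  shows "x \<in> enlargement euclidean_metric A r"
proof -
  obtain y where "y \<in> A" "dist y z < r - dist x z"
    using assms by (auto simp: closure_approachable dest!: spec[of _ "r - dist x z"])
  moreover have "dist x y \<le> dist x z + dist y z" by (metis dist_commute dist_triangle)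
  ultimately show ?thesis by (auto simp: enlargement_euclidean intro!: bexI[of _ y])
qed

text \<open>Adding a limit point to a connected set keeps it connected, so a component contains all its limit
  points in the ambient set.  For the complement of a closed set, the end points of a component
  therefore belong to the closed set.\<close>

lemma component_closure_diff:
  fixes T :: "'a::topological_space set"
  assumes T: "T \<in> components U" and x: "x \<in> closure T" "x \<in> U"
  shows "x \<in> T"
proof -
  have "connected (insert x T)"
    by (rule connected_intermediate_closure[of T])
      (use T x closure_subset in \<open>auto intro: in_components_connected\<close>)
  then have "insert x T \<subseteq> T"
    using components_maximal[OF T] in_components_subset[OF T] in_components_nonempty[OF T] x by auto
  then show ?thesis by simp
qed

lemma strict_lower_bounds_eq_atMost:
  fixes T :: "real set"
  assumes T: "open T" "connected T" "t \<in> T" and l: "\<exists>x. \<forall>t\<in>T. x < t"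
  obtains \<alpha> where "{x. \<forall>t\<in>T. x < t} = {..\<alpha>}" "{\<alpha><..t} \<subseteq> T" "\<alpha> \<in> closure T" "\<alpha> < t" "\<alpha> \<notin> T"
proof
  let ?a = "Inf T"
  have bdd: "bdd_below T" using l by (auto simp: bdd_below_def intro: less_imp_le)
  have "\<exists>s\<in>T. s < u" if "u \<in> T" for u
  proof -
    obtain e where "e > 0" "ball u e \<subseteq> T" by (rule openE[OF T(1) \<open>u \<in> T\<close>])
    moreover from this have "u - e/2 \<in> ball u e" by (simp add: dist_real_def)
    ultimately show ?thesis by (intro bexI[of _ "u - e/2"]) auto
  qed
  then have lower: "?a < u" if "u \<in> T" for u
    using cInf_lower[OF _ bdd] that by (meson le_less_trans)
  show "{x. \<forall>t\<in>T. x < t} = {..?a}"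
  proof (intro subset_antisym subsetI)
    fix x assume "x \<in> {x. \<forall>t\<in>T. x < t}"
    then have "x \<le> ?a" using T(3) by (intro cInf_greatest) (auto intro: less_imp_le)
    then show "x \<in> {..?a}" by simp
  qed (use lower in \<open>auto intro: le_less_trans\<close>)
  show "{?a<..t} \<subseteq> T"
  proof
    fix x assume x: "x \<in> {?a<..t}"
    then obtain s where "s \<in> T" "s < x" using cInf_less_iff[of T x] T(3) bdd by auto
    then show "x \<in> T" using connected_contains_Icc[OF T(2) _ T(3), of s] x by auto
  qed
  show "?a \<in> closure T" using closure_contains_Inf[of T] T(3) bdd by auto
  show "?a < t" "?a \<notin> T" using lower T(3) by auto
qed

lemma strict_upper_bounds_eq_atLeast:
  fixes T :: "real set"
  assumes T: "open T" "connected T" "t \<in> T" and l: "\<exists>x. \<forall>t\<in>T. t < x"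
  obtains \<beta> where "{x. \<forall>t\<in>T. t < x} = {\<beta>..}" "{t..<\<beta>} \<subseteq> T" "\<beta> \<in> closure T" "t < \<beta>" "\<beta> \<notin> T"
proof
  let ?a = "Sup T"
  have bdd: "bdd_above T" using l by (auto simp: bdd_above_def intro: less_imp_le)
  have "\<exists>s\<in>T. u < s" if "u \<in> T" for u
  proof -
    obtain e where "e > 0" "ball u e \<subseteq> T" by (rule openE[OF T(1) \<open>u \<in> T\<close>])
    moreover from this have "u + e/2 \<in> ball u e" by (simp add: dist_real_def)
    ultimately show ?thesis by (intro bexI[of _ "u + e/2"]) auto
  qed
  then have upper: "u < ?a" if "u \<in> T" for u
    using cSup_upper[OF _ bdd] that by (meson less_le_trans)
  show "{x. \<forall>t\<in>T. t < x} = {?a..}"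
  proof (intro subset_antisym subsetI)
    fix x assume "x \<in> {x. \<forall>t\<in>T. t < x}"
    then have "?a \<le> x" using T(3) by (intro cSup_least) (auto intro: less_imp_le)
    then show "x \<in> {?a..}" by simp
  qed (use upper in \<open>auto intro: less_le_trans\<close>)
  show "{t..<?a} \<subseteq> T"
  proof
    fix x assume x: "x \<in> {t..<?a}"
    then obtain s where "s \<in> T" "x < s" using less_cSup_iff[of T x] T(3) bdd by auto
    then show "x \<in> T" using connected_contains_Icc[OF T(2) T(3), of s] x by auto
  qed
  show "?a \<in> closure T" using closure_contains_Sup[of T] T(3) bdd by auto
  show "t < ?a" "?a \<notin> T" using upper T(3) by auto
qed

context odd_quantile
begin

abbreviation enl :: "real set \<Rightarrow> real \<Rightarrow> real set" where
  "enl \<equiv> enlargement euclidean_metric"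

lemma law_metric_prob_space: "metric_prob_space euclidean_metric law"
  by (rule metric_prob_space_euclidean) (auto intro: law.prob_space_axioms)

lemma enl_sets: "enl A r \<in> sets law"
  by (intro openin_sets[OF law_metric_prob_space] openin_enlargement) simp

text \<open>Let \<open>L\<close> and \<open>R\<close> be the parts of the line to the left and to the right of the component \<open>T\<close>.  Their
  end points belong to the closure of \<open>A\<close>, so the enlargement of \<open>A\<close> enters \<open>T\<close> from both sides and
  gains \<open>r\<close> times almost \<open>l\<close> of the masses of \<open>L\<close> and \<open>R\<close>.  The sum is at least \<open>l\<close> of the mass of \<open>L\<close> and \<open>R\<close>
  together, which is \<open>l\<close> of the mass of \<open>T\<close>.\<close>

lemma component_gain:
  assumes T: "T \<in> components (- closure A)" and k: "k < l (measure law T)"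
  shows "eventually (\<lambda>r. k * r \<le> measure law (T \<inter> enl A r)) (at_right 0)"
proof -
  have oT: "open T" by (rule open_components[OF _ T]) auto
  have cT: "connected T" using T by (rule in_components_connected)
  have TU: "T \<subseteq> - closure A" using T by (rule in_components_subset)
  \<comment> \<open>A point of \<open>T\<close> keeps the gains at the two ends disjoint\<close>
  obtain t where t: "t \<in> T" using in_components_nonempty[OF T] by auto
  have end_in: "x \<in> closure A" if "x \<in> closure T" "x \<notin> T" for x
    using component_closure_diff[OF T that(1)] that(2) by auto
  define L where "L = {x. \<forall>t\<in>T. x < t}"
  define R where "R = {x. \<forall>t\<in>T. t < x}"
  have left: "L \<in> sets law \<and> (\<forall>k<l (measure law L).
     eventually (\<lambda>r. k * r \<le> measure law (T \<inter> {..<t} \<inter> enl A r)) (at_right 0))"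
  proof (cases "L = {}")
    case True
    show ?thesis using True l_0 by (auto intro: eventually_nonpos_mult_le_measure)
  next
    case False
    then obtain \<alpha> where \<alpha>: "L = {..\<alpha>}" "{\<alpha><..t} \<subseteq> T" "\<alpha> \<in> closure T" "\<alpha> < t" "\<alpha> \<notin> T"
      using strict_lower_bounds_eq_atMost[OF oT cT t] unfolding L_def by auto
    have "eventually (\<lambda>r. k * r \<le> measure law (T \<inter> {..<t} \<inter> enl A r)) (at_right 0)"
      if k: "k < l (measure law L)" for k
    proof (cases "measure law L \<in> {0<..<1}")
      case True
      have G: "G (measure law L) = \<alpha>" using G_of_measure_atMost[of \<alpha>] True \<alpha>(1) by simp
      have "eventually (\<lambda>r. r \<in> {0<..<t - \<alpha>}) (at_right 0)"
        using \<alpha> by (intro eventually_at_right_real) auto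
      with right_gain[OF True k] show ?thesis
      proof eventually_elim
        case (elim r)
        have "{\<alpha><..<\<alpha> + r} \<subseteq> T \<inter> {..<t} \<inter> enl A r"
          using elim \<alpha> closure_subset_enlargement[OF end_in[OF \<alpha>(3,5)], of _ r]
          by (auto simp: dist_real_def)
        then have "measure law {\<alpha><..<\<alpha> + r} \<le> measure law (T \<inter> {..<t} \<inter> enl A r)"
          using oT enl_sets[of A r] by (intro law.finite_measure_mono) auto
        then show ?case using elim G by simp
      qed
    next
      case False
      then have "measure law L = 0 \<or> measure law L = 1"
        using law.prob_le_1[of L] measure_nonneg[of law L] by auto
      then have "k < 0" using k l_0 l_reflect[of 0] by auto
      then show ?thesis by (intro eventually_nonpos_mult_le_measure) simp
    qed
    then show ?thesis using \<alpha> by simp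
  qed
  have right: "R \<in> sets law \<and> (\<forall>k<l (measure law R).
     eventually (\<lambda>r. k * r \<le> measure law (T \<inter> {t<..} \<inter> enl A r)) (at_right 0))"
  proof (cases "R = {}")
    case True
    show ?thesis using True l_0 by (auto intro: eventually_nonpos_mult_le_measure)
  next
    case False
    then obtain \<beta> where \<beta>: "R = {\<beta>..}" "{t..<\<beta>} \<subseteq> T" "\<beta> \<in> closure T" "t < \<beta>" "\<beta> \<notin> T"
      using strict_upper_bounds_eq_atLeast[OF oT cT t] unfolding R_def by auto
    have "uminus -` {\<beta>..} = {..- \<beta>}" by auto
    then have reflected: "measure law {..- \<beta>} = measure law R"
      using measure_law_reflect[of "{\<beta>..}"] \<beta>(1) by simp
    have "eventually (\<lambda>r. k * r \<le> measure law (T \<inter> {t<..} \<inter> enl A r)) (at_right 0)"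
      if k: "k < l (measure law R)" for k
    proof (cases "measure law R \<in> {0<..<1}")
      case True
      have G: "G (1 - measure law R) = \<beta>"
        using G_of_measure_atMost[of "- \<beta>"] True G_odd[of "measure law R"] by (simp add: reflected)
      have "eventually (\<lambda>r. r \<in> {0<..<\<beta> - t}) (at_right 0)"
        using \<beta> by (intro eventually_at_right_real) auto
      moreover have "eventually (\<lambda>r. k * r \<le> measure law {\<beta> - r<..<\<beta>}) (at_right 0)"
        using left_gain[of "1 - measure law R" k] True k l_reflect[of "measure law R"] G by auto
      ultimately show ?thesis
      proof eventually_elim
        case (elim r)
        have "{\<beta> - r<..<\<beta>} \<subseteq> T \<inter> {t<..} \<inter> enl A r"
          using elim \<beta> closure_subset_enlargement[OF end_in[OF \<beta>(3,5)], of _ r]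
          by (auto simp: dist_real_def)
        then have "measure law {\<beta> - r<..<\<beta>} \<le> measure law (T \<inter> {t<..} \<inter> enl A r)"
          using oT enl_sets[of A r] by (intro law.finite_measure_mono) auto
        then show ?case using elim by simp
      qed
    next
      case False
      then have "measure law R = 0 \<or> measure law R = 1"
        using law.prob_le_1[of R] measure_nonneg[of law R] by auto
      then have "k < 0" using k l_0 l_reflect[of 0] by auto
      then show ?thesis by (intro eventually_nonpos_mult_le_measure) simp
    qed
    then show ?thesis using \<beta> by simp
  qed
  have "x \<in> T" if x: "x \<notin> L" "x \<notin> R" for x
  proof -
    obtain t1 t2 where "t1 \<in> T" "t1 \<le> x" "t2 \<in> T" "x \<le> t2"
      using x by (auto simp: L_def R_def not_less)
    then show ?thesis using connected_contains_Icc[OF cT, of t1 t2] by auto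
  qed
  then have compl: "- T = L \<union> R" using t by (auto simp: L_def R_def) 
  have "L \<inter> R = {}" using t by (force simp: L_def R_def)
  then have "measure law (- T) = measure law L + measure law R"
    using left right unfolding compl by (intro law.finite_measure_Union) auto
  moreover have "measure law (- T) = 1 - measure law T"
    using law.prob_compl[of T] oT by (simp add: Compl_eq_Diff_UNIV)
  ultimately have m: "measure law L + measure law R = 1 - measure law T" by simp
  have "l (measure law T) = l (measure law L + measure law R)"
    unfolding m by (simp add: l_reflect)
  also have "\<dots> \<le> l (measure law L) + l (measure law R)"
    using m by (intro l_subadditive) auto
  finally have le: "l (measure law T) \<le> l (measure law L) + l (measure law R)" .
  define d where "d = (l (measure law T) - k) / 2"
  have d: "d > 0" using k by (simp add: d_def)
  have "eventually (\<lambda>r. (l (measure law L) - d) * r \<le> measure law (T \<inter> {..<t} \<inter> enl A r)) (at_right 0)"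
    using left d by auto
  moreover have "eventually (\<lambda>r. (l (measure law R) - d) * r \<le> measure law (T \<inter> {t<..} \<inter> enl A r)) (at_right 0)"
    using right d by auto
  ultimately show ?thesis
    using eventually_at_right_less[of 0]
  proof eventually_elim
    case (elim r)
    have "k \<le> (l (measure law L) - d) + (l (measure law R) - d)"
      using le by (simp add: d_def field_simps)
    then have "k * r \<le> ((l (measure law L) - d) + (l (measure law R) - d)) * r"
      using elim by (intro mult_right_mono) auto
    also have "\<dots> \<le> measure law (T \<inter> {..<t} \<inter> enl A r) + measure law (T \<inter> {t<..} \<inter> enl A r)"
      using add_mono[OF elim(1,2)] by (simp only: distrib_right)
    also have "\<dots> = measure law ((T \<inter> {..<t} \<inter> enl A r) \<union> (T \<inter> {t<..} \<inter> enl A r))"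
      using oT enl_sets[of A r] by (intro law.finite_measure_Union[symmetric]) auto
    also have "\<dots> \<le> measure law (T \<inter> enl A r)"
      using oT enl_sets[of A r] by (intro law.finite_measure_mono) auto
    finally show ?case .
  qed
qed

text \<open>By inner regularity finitely many components of the complement of the closure carry almost all of its
  mass.  Their gains add up, and \<open>l\<close> is subadditive and continuous.\<close>

lemma gap_gain:
  assumes A: "A \<in> sets borel" and cl: "measure law (closure A) = measure law A"
    and k: "k < l (measure law A)"
  shows "eventually (\<lambda>r. k * r \<le> measure law (enl A r) - measure law A) (at_right 0)"
proof -
  let ?U = "- closure A"
  have mU: "measure law ?U = 1 - measure law A"
    using law.prob_compl[of "closure A"] cl by (simp add: Compl_eq_Diff_UNIV)
  have lU: "l (measure law ?U) = l (measure law A)" unfolding mU by (simp add: l_reflect)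
  have comp_open: "open T" if "T \<in> components ?U" for T
    by (rule open_components[OF _ that]) auto
  have "\<exists>F. finite F \<and> F \<subseteq> components ?U \<and> k < l (\<Sum>T\<in>F. measure law T)"
  proof (cases "measure law ?U \<in> {0<..<1}")
    case False
    then have "measure law ?U = 0 \<or> measure law ?U = 1"
      using law.prob_le_1[of ?U] measure_nonneg[of law ?U] by auto
    then have "k < 0" using k lU l_0 l_reflect[of 0] by auto
    then show ?thesis using l_0 by (intro exI[of _ "{}"]) auto
  next
    case True
    have "eventually (\<lambda>x. k < l x) (at (measure law ?U))"
      using isCont_l[of "measure law ?U"] True k lU
      by (intro order_tendstoD(1)[of l "l (measure law ?U)"]) (auto simp: isCont_def)
    then obtain e where e: "e > 0" "\<And>x. x \<noteq> measure law ?U \<Longrightarrow> dist x (measure law ?U) < e \<Longrightarrow> k < l x"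
      unfolding eventually_at by auto
    have e': "k < l x" if "dist x (measure law ?U) < e" for x
      using e(2)[of x] that k lU by (cases "x = measure law ?U") auto
    have "emeasure law ?U = (SUP K\<in>{K. K \<subseteq> ?U \<and> compact K}. emeasure law K)"
      by (rule inner_regular) (auto simp: law.emeasure_eq_measure)
    moreover have "ennreal (measure law ?U - e) < emeasure law ?U"
      unfolding law.emeasure_eq_measure using e(1) True by (intro ennreal_lessI) auto
    \<comment> \<open>A compact set is covered by finitely many of the open components\<close>
    ultimately obtain K where K: "K \<subseteq> ?U" "compact K" "ennreal (measure law ?U - e) < emeasure law K"
      by (auto simp: less_SUP_iff)
    have "K \<subseteq> \<Union>(components ?U)" using K(1) by simp
    with K(2) obtain F where F: "F \<subseteq> components ?U" "finite F" "K \<subseteq> \<Union>F"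
      using compactE[of K "components ?U"] comp_open by blast
    have disj: "disjoint F"
      using F(1) pairwise_disjoint_components[of ?U] by (auto simp: pairwise_def disjoint_def disjnt_def)
    have "(\<Sum>T\<in>F. measure law T) = measure law (\<Union>F)"
      using F disj comp_open
      by (subst law.finite_measure_finite_Union[of F "\<lambda>T. T", simplified])
        (auto simp: disjoint_family_on_def disjoint_def)
    moreover have "measure law K \<le> measure law (\<Union>F)"
      using F comp_open by (intro law.finite_measure_mono F(3)) (auto intro!: borel_open)
    moreover have "measure law (\<Union>F) \<le> measure law ?U"
    proof (rule law.finite_measure_mono)
      show "\<Union>F \<subseteq> ?U" using F(1) in_components_subset by blast
    qed simp
    moreover have "measure law ?U - e < measure law K"
      using K(3) ennreal_leI[of "measure law K" "measure law ?U - e"]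
      unfolding law.emeasure_eq_measure not_le[symmetric] by blast
    ultimately have "dist (\<Sum>T\<in>F. measure law T) (measure law ?U) < e"
      by (simp add: dist_real_def)
    then show ?thesis using F e' by blast
  qed
  then obtain F where F: "finite F" "F \<subseteq> components ?U" "k < l (\<Sum>T\<in>F. measure law T)" by blast
  have opF: "open T" if "T \<in> F" for T using that F comp_open by blast
  have disj: "T \<inter> T' = {}" if "T \<in> F" "T' \<in> F" "T \<noteq> T'" for T T'
    using pairwise_disjoint_components[of ?U] that F(2) by (auto simp: pairwise_def disjnt_def)
  have sum1: "(\<Sum>T\<in>F. measure law T) \<le> 1"
  proof -
    have "(\<Sum>T\<in>F. measure law T) = measure law (\<Union>T\<in>F. T)"
      using F disj opF by (intro law.finite_measure_finite_Union[symmetric])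
        (auto simp: disjoint_family_on_def)
    then show ?thesis by simp
  qed
  have sub: "l (\<Sum>T\<in>F. measure law T) \<le> (\<Sum>T\<in>F. l (measure law T))"
    using F sum1 by (intro l_sum_le) auto
  define d where "d = (l (\<Sum>T\<in>F. measure law T) - k) / (real (card F) + 1)"
  have d: "d > 0" using F by (simp add: d_def)
  have kd: "k \<le> (\<Sum>T\<in>F. l (measure law T) - d)"
  proof -
    have "real (card F) * d \<le> (real (card F) + 1) * d" using d by simp
    also have "\<dots> = l (\<Sum>T\<in>F. measure law T) - k" by (simp add: d_def)
    finally show ?thesis using sub by (simp add: sum_subtractf)
  qed
  have "eventually (\<lambda>r. \<forall>T\<in>F. (l (measure law T) - d) * r \<le> measure law (T \<inter> enl A r)) (at_right 0)"
    using F d by (intro eventually_ball_finite ballI component_gain) auto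
  with eventually_at_right_less[of 0] show ?thesis
  proof eventually_elim
    case (elim r)
    let ?V = "\<Union>T\<in>F. T \<inter> enl A r"
    have "k * r \<le> (\<Sum>T\<in>F. l (measure law T) - d) * r"
      using kd elim by (intro mult_right_mono) auto
    also have "\<dots> \<le> (\<Sum>T\<in>F. measure law (T \<inter> enl A r))"
      unfolding sum_distrib_right using elim by (intro sum_mono) auto
    also have "\<dots> = measure law ?V"
      using F disj opF enl_sets[of A r]
      by (intro law.finite_measure_finite_Union[symmetric]) (auto simp: disjoint_family_on_def)
    finally have "k * r \<le> measure law ?V" .
    moreover have "measure law (closure A) + measure law ?V = measure law (closure A \<union> ?V)"
    proof (rule law.finite_measure_Union[symmetric])
      have "T \<in> sets law" if "T \<in> F" for T using opF[OF that] by simp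
      then show "?V \<in> sets law" by (intro sets.finite_UN F(1) sets.Int enl_sets)
      have "T \<subseteq> ?U" if "T \<in> F" for T 
        by (rule in_components_subset[OF subsetD[OF F(2) that]])
      then show "closure A \<inter> ?V = {}" by blast
    qed simp
    moreover have "closure A \<union> ?V \<subseteq> enl A r"
      using elim closure_subset_enlargement[of _ A _ r] by auto
    then have "measure law (closure A \<union> ?V) \<le> measure law (enl A r)"
      using enl_sets by (intro law.finite_measure_mono)
    ultimately show ?case using cl by linarith
  qed
qed

text \<open>If the closure of \<open>A\<close> has larger measure than \<open>A\<close>, then every enlargement of \<open>A\<close> exceeds it by a fixed
  amount, and the boundary measure is infinite.\<close>

lemma l_le_outer_boundary:
  assumes A: "A \<in> sets borel"
  shows "ennreal (l (measure law A)) \<le> outer_boundary euclidean_metric law A"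
proof -
  let ?p = "measure law A"
  have ev: "eventually (\<lambda>r. k * r \<le> measure law (enl A r) - ?p) (at_right 0)" if k: "k < l ?p" for k
  proof (cases "measure law (closure A) = ?p")
    case True
    then show ?thesis by (rule gap_gain[OF A _ k])
  next
    case False
    have "?p \<le> measure law (closure A)"
      using closure_subset[of A] by (intro law.finite_measure_mono) auto
    then have gap: "0 < measure law (closure A) - ?p" using False by simp
    have "((\<lambda>r. k * r) \<longlongrightarrow> k * 0) (at_right 0)" by (intro tendsto_intros)
    then have "eventually (\<lambda>r. k * r < measure law (closure A) - ?p) (at_right 0)"
      using gap by (intro order_tendstoD) auto
    with eventually_at_right_less[of 0] show ?thesis
    proof eventually_elim
      case (elim r)
      have "closure A \<subseteq> enl A r" using elim closure_subset_enlargement[of _ A _ r] by auto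
      then have "measure law (closure A) \<le> measure law (enl A r)"
        using enl_sets by (intro law.finite_measure_mono)
      then show ?case using elim by linarith
    qed
  qed
  have le: "ennreal k \<le> outer_boundary euclidean_metric law A" if "k < l ?p" for k
    unfolding outer_boundary_def
  proof (rule Liminf_bounded)
    from ev[OF that] eventually_at_right_less[of 0]
    show "eventually (\<lambda>r. ennreal k \<le> ennreal ((measure law (enl A r) - ?p) / r)) (at_right 0)"
      by eventually_elim (auto intro!: ennreal_leI simp: field_simps)
  qed
  have "((\<lambda>k. ennreal k) \<longlongrightarrow> ennreal (l ?p)) (at_left (l ?p))"
    by (intro tendsto_ennrealI tendsto_ident_at)
  moreover have "eventually (\<lambda>k. ennreal k \<le> outer_boundary euclidean_metric law A) (at_left (l ?p))"
    using le by (auto simp: eventually_at_filter)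
  ultimately show ?thesis by (intro tendsto_upperbound[where F="at_left (l ?p)"]) auto
qed

lemma outer_boundary_half_line:
  assumes p: "p \<in> {0<..<1}"
  shows "outer_boundary euclidean_metric law {..G p} \<le> ennreal (l p)"
proof -
  have le: "outer_boundary euclidean_metric law {..G p} \<le> ennreal k" if k: "l p < k" for k
    unfolding outer_boundary_def
  proof (rule Liminf_le)
    from G_increment_greater[OF p k] eventually_at_right_less[of 0]
    show "eventually (\<lambda>r. ennreal ((measure law (enl {..G p} r) - measure law {..G p}) / r) \<le> ennreal k) (at_right 0)"
    proof eventually_elim
      case (elim r)
      have k0: "0 < k" using k l_pos[of p] p by auto
      then have q: "p + k * r \<in> {0<..<1}" using elim p by (auto intro: add_pos_pos)
      have "enl {..G p} r \<subseteq> {..G (p + k * r)}"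
        using elim by (auto simp: enlargement_euclidean dist_real_def)
      then have "measure law (enl {..G p} r) \<le> measure law {..G (p + k * r)}"
        by (intro law.finite_measure_mono) auto
      then have "measure law (enl {..G p} r) - measure law {..G p} \<le> k * r"
        using measure_law_atMost[OF p] measure_law_atMost[OF q] by simp
      then show ?case using elim by (intro ennreal_leI) (simp add: field_simps)
    qed
  qed simp
  have "((\<lambda>k. ennreal k) \<longlongrightarrow> ennreal (l p)) (at_right (l p))"
    by (intro tendsto_ennrealI tendsto_ident_at)
  moreover have "eventually (\<lambda>k. outer_boundary euclidean_metric law {..G p} \<le> ennreal k) (at_right (l p))"
    using le by (auto simp: eventually_at_filter)
  ultimately show ?thesis by (intro tendsto_lowerbound[where F="at_right (l p)"]) auto
qed

end

section \<open>The three ranges of the profile\<close>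

lemma isoperimetric_0_1:
  assumes X: "metric_prob_space X \<mu>"
  shows "isoperimetric X \<mu> 0 = 0" "isoperimetric X \<mu> 1 = 0"
proof -
  interpret prob_space \<mu> using X by (simp add: metric_prob_space_def)
  have sp: "space \<mu> = mspace X" using X by (simp add: metric_prob_space_def)
  have o: "outer_boundary X \<mu> {} = 0"
    by (simp add: outer_boundary_def enlargement_eq Liminf_const)
  then have i: "inner_boundary X \<mu> (mspace X) = 0" by (simp add: inner_boundary_def)
  have e: "{} \<in> borel_sets_of X" by (simp add: borel_sets_of_def sigma_sets.Empty)
  then have f: "mspace X \<in> borel_sets_of X" using borel_sets_of_compl by fastforce
  have "isoperimetric X \<mu> 0 \<le> min (outer_boundary X \<mu> {}) (inner_boundary X \<mu> {})"
    unfolding isoperimetric_def using e by (intro INF_lower) simp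
  then show "isoperimetric X \<mu> 0 = 0" using o by simp
  have "isoperimetric X \<mu> 1 \<le> min (outer_boundary X \<mu> (mspace X)) (inner_boundary X \<mu> (mspace X))"
    unfolding isoperimetric_def using f prob_space sp by (intro INF_lower) simp
  then show "isoperimetric X \<mu> 1 = 0" using i by simp
qed

lemma L_fun_0_1: "L_fun c 0 = 0" "L_fun c 1 = 0"
  by (simp_all add: L_fun_model_profile)

lemma L_fun_reflect: "L_fun c (1 - p) = L_fun c p"
  by (simp add: L_fun_model_profile model_profile_reflect)

lemma L_fun_scale:
  assumes c: "\<forall>a\<in>{1/2..1}. 0 \<le> c a" and p: "0 \<le> p" "p \<le> 1" and t: "0 \<le> t" "t \<le> 1"
  shows "ennreal t * L_fun c p \<le> L_fun c (t * p)"
  unfolding L_fun_model_profile SUP_mult_left_ennreal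
proof (rule SUP_mono)
  fix a :: real assume a: "a \<in> {1/2..1}"
  have "c a * (t * model_profile (1/a) p) \<le> c a * model_profile (1/a) (t * p)"
    using a c p t by (intro mult_left_mono model_profile_scale) (auto simp: field_simps)
  then have "ennreal t * ennreal (c a * model_profile (1/a) p) \<le> ennreal (c a * model_profile (1/a) (t * p))"
    using t by (simp add: ennreal_mult'[symmetric] ennreal_leI mult.left_commute)
  then show "\<exists>b\<in>{1/2..1}. ennreal t * ennreal (c a * model_profile (1/a) p)
      \<le> ennreal (c b * model_profile (1/b) (t * p))"
    using a by blast
qed

lemma L_fun_comparable:
  assumes c: "\<forall>a\<in>{1/2..1}. 0 \<le> c a" and p: "p \<in> {0<..<1}" and q: "q \<in> {0<..<1}"
  obtains t where "0 < t" "ennreal t * L_fun c q \<le> L_fun c p"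
proof (cases "p \<le> q")
  case True
  show thesis
    by (rule that[of "p / q"]) (use L_fun_scale[OF c, of q "p / q"] True p q in auto)
next
  case False
  have "ennreal ((1 - p) / (1 - q)) * L_fun c (1 - q) \<le> L_fun c (1 - p)"
    using L_fun_scale[OF c, of "1 - q" "(1 - p) / (1 - q)"] False p q by auto
  then show thesis
    by (intro that[of "(1 - p) / (1 - q)"]) (use p q in \<open>auto simp: L_fun_reflect\<close>)
qed

text \<open>The values of \<open>L\<close> at any two points of \<open>{0<..<1}\<close> bound each other up to a positive factor, so they vanish or
  are infinite together.\<close>

lemma L_fun_cases:
  assumes c: "\<forall>a\<in>{1/2..1}. 0 \<le> c a"
  obtains (zero) "\<forall>p\<in>{0..1}. L_fun c p = 0"
  | (top) "\<forall>p\<in>{0<..<1}. L_fun c p = \<top>"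
  | (finite) "\<forall>p\<in>{0<..<1}. 0 < L_fun c p \<and> L_fun c p < \<top>"
proof -
  have half: "(1/2::real) \<in> {0<..<1}" by simp
  have up: "L_fun c p = \<top>" if h: "L_fun c (1/2) = \<top>" and p: "p \<in> {0<..<1}" for p
  proof -
    obtain t where "0 < t" "ennreal t * L_fun c (1/2) \<le> L_fun c p"
      by (rule L_fun_comparable[OF c p half])
    then show ?thesis using h by (simp add: ennreal_mult_top top_unique)
  qed
  have pos: "0 < L_fun c p" if h: "L_fun c (1/2) \<noteq> 0" and p: "p \<in> {0<..<1}" for p
  proof -
    obtain t where "0 < t" "ennreal t * L_fun c (1/2) \<le> L_fun c p"
      by (rule L_fun_comparable[OF c p half])
    moreover have "0 < ennreal t * L_fun c (1/2)"
      using calculation(1) h by (simp add: ennreal_zero_less_mult_iff zero_less_iff_neq_zero)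
    ultimately show ?thesis by (auto intro: less_le_trans)
  qed
  have fin: "L_fun c p < \<top>" if h: "L_fun c (1/2) \<noteq> \<top>" and p: "p \<in> {0<..<1}" for p
  proof -
    obtain t where t: "0 < t" "ennreal t * L_fun c p \<le> L_fun c (1/2)"
      by (rule L_fun_comparable[OF c half p])
    then have "L_fun c p = \<top> \<Longrightarrow> L_fun c (1/2) = \<top>" by (simp add: ennreal_mult_top top_unique)
    then show ?thesis using h top.not_eq_extremum by metis
  qed
  have nul: "L_fun c p = 0" if "L_fun c (1/2) = 0" "p \<in> {0..1}" for p
  proof (cases "p \<in> {0<..<1}")
    case True
    obtain t where t: "0 < t" "ennreal t * L_fun c p \<le> L_fun c (1/2)"
      by (rule L_fun_comparable[OF c half True])
    then show ?thesis using that by (auto simp: ennreal_eq_0_iff)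
  next
    case False
    then have "p = 0 \<or> p = 1" using that(2) by auto
    then show ?thesis using L_fun_0_1 by auto
  qed
  show thesis
    using zero top finite up pos fin nul by (metis (no_types, lifting))
qed

section \<open>The measure for the vanishing profile\<close>

text \<open>The atoms have the masses \<open>2 powr (- k - 1)\<close>, so \<open>S\<close> can be read off the binary digits of \<open>p\<close>: the
  digit number \<open>k + 1\<close> is the parity of \<open>\<lfloor>2^(k + 1) * p\<rfloor>\<close>.\<close>

lemma geometric_half_subset:
  assumes "p \<in> {0..1}"
  obtains S where "measure_pmf.prob (geometric_pmf (1/2)) S = p"
proof (cases "p = 1")
  case True
  then show thesis using that[of UNIV] by simp
next
  case False
  define d where "d = (\<lambda>n::nat. \<lfloor>2 ^ n * p\<rfloor>)"
  define S where "S = {k. odd (d (Suc k))}"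
  have step: "d (Suc n) = 2 * d n + (if n \<in> S then 1 else 0)" for n
  proof -
    have "2 * d n \<le> d (Suc n)" "d (Suc n) < 2 * d n + 2"
      unfolding d_def by (simp_all add: le_floor_iff floor_less_iff) linarith+
    then have "d (Suc n) = 2 * d n \<or> d (Suc n) = 2 * d n + 1" by linarith
    then show ?thesis by (auto simp: S_def)
  qed
  have fin: "measure_pmf.prob (geometric_pmf (1/2)) (S \<inter> {..<n}) = d n / 2 ^ n" for n
  proof (induction n)
    case 0
    have "\<lfloor>p\<rfloor> = 0" using assms False by (simp add: floor_eq_iff)
    then show ?case by (simp add: d_def)
  next
    case (Suc n)
    have "measure_pmf.prob (geometric_pmf (1/2)) (S \<inter> {..<Suc n}) =
      measure_pmf.prob (geometric_pmf (1/2)) (S \<inter> {..<n}) + (if n \<in> S then 1 / 2 ^ Suc n else 0)"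
      by (simp add: measure_measure_pmf_finite lessThan_Suc power_one_over)
    also have "\<dots> = d (Suc n) / 2 ^ Suc n"
      by (simp add: Suc step field_simps)
    finally show ?case .
  qed
  have "(\<lambda>n. measure_pmf.prob (geometric_pmf (1/2)) (S \<inter> {..<n})) \<longlonglongrightarrow>
      measure_pmf.prob (geometric_pmf (1/2)) (\<Union>n. S \<inter> {..<n})"
    by (intro measure_pmf.finite_Lim_measure_incseq) (auto simp: incseq_def)
  moreover have "(\<Union>n. S \<inter> {..<n}) = S" by auto
  moreover have "(\<lambda>n. d n / 2 ^ n) \<longlonglongrightarrow> p"
  proof (rule tendsto_sandwich[of "\<lambda>n. p - (1/2) ^ n" _ _ "\<lambda>n. p"])
    have "p - (1/2) ^ n \<le> d n / 2 ^ n" "d n / 2 ^ n \<le> p" for n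
    proof -
      have "2 ^ n * p - 1 < d n" "d n \<le> 2 ^ n * p" unfolding d_def by linarith+
      then have "(2 ^ n * p - 1) / 2 ^ n \<le> d n / 2 ^ n" "d n / 2 ^ n \<le> 2 ^ n * p / 2 ^ n"
        by (intro divide_right_mono; simp)+
      then show "p - (1/2) ^ n \<le> d n / 2 ^ n" "d n / 2 ^ n \<le> p"
        by (simp_all add: diff_divide_distrib power_one_over)
    qed
    then show "eventually (\<lambda>n. p - (1/2) ^ n \<le> d n / 2 ^ n) sequentially"
      "eventually (\<lambda>n. d n / 2 ^ n \<le> p) sequentially" by auto
    have "(\<lambda>n. p - (1/2) ^ n) \<longlonglongrightarrow> p - 0" by (intro tendsto_intros LIMSEQ_power_zero) simp
    then show "(\<lambda>n. p - (1/2) ^ n) \<longlonglongrightarrow> p" by simp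
  qed simp
  ultimately have "measure_pmf.prob (geometric_pmf (1/2)) S = p"
    using LIMSEQ_unique by (simp add: fin)
  then show thesis by (rule that)
qed

text \<open>Since the atoms lie at integers, they are at distance at least \<open>1\<close> from each other, and an enlargement by
  less than \<open>1\<close> of a set of atoms gains no mass.\<close>

definition signed_geometric :: "real pmf" where
  "signed_geometric = map_pmf (\<lambda>(k, b). if b then real k + 1 else - (real k + 1))
     (pair_pmf (geometric_pmf (1/2)) (bernoulli_pmf (1/2)))"

lemma signed_geometric_uminus: "map_pmf uminus signed_geometric = signed_geometric"
proof -
  have "map_pmf Not (bernoulli_pmf (1/2)) = bernoulli_pmf (1/2)"
  proof (rule pmf_eqI)
    fix b
    have "pmf (map_pmf Not (bernoulli_pmf (1/2))) (Not (\<not> b)) = pmf (bernoulli_pmf (1/2)) (\<not> b)"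
      by (rule pmf_map_inj') (simp add: inj_def)
    then show "pmf (map_pmf Not (bernoulli_pmf (1/2))) b = pmf (bernoulli_pmf (1/2)) b"
      by (cases b) simp_all
  qed
  then have "signed_geometric = map_pmf (\<lambda>(k, b). if b then real k + 1 else - (real k + 1))
     (pair_pmf (geometric_pmf (1/2)) (map_pmf Not (bernoulli_pmf (1/2))))"
    by (simp add: signed_geometric_def)
  also have "\<dots> = map_pmf uminus signed_geometric"
    unfolding signed_geometric_def pair_map_pmf2 map_pmf_comp
    by (intro map_pmf_cong) auto
  finally show ?thesis ..
qed

lemma signed_geometric_subset:
  assumes "p \<in> {0..1}"
  obtains A where "A \<subseteq> set_pmf signed_geometric" "measure_pmf.prob signed_geometric A = p"
proof -
  obtain S where S: "measure_pmf.prob (geometric_pmf (1/2)) S = p"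
    by (rule geometric_half_subset[OF assms])
  \<comment> \<open>The magnitude \<open>\<bar>x\<bar> - 1\<close> recovers the geometric variable\<close>
  define h where "h = (\<lambda>x::real. nat (\<lfloor>\<bar>x\<bar>\<rfloor> - 1))"
  have "map_pmf h signed_geometric =
      map_pmf fst (pair_pmf (geometric_pmf (1/2)) (bernoulli_pmf (1/2)))"
    unfolding signed_geometric_def map_pmf_comp
    by (intro map_pmf_cong refl) (auto simp: h_def abs_if)
  then have "geometric_pmf (1/2) = map_pmf h signed_geometric" by (simp add: map_fst_pair_pmf)
  then have "measure_pmf.prob signed_geometric (h -` S) = p"
    using S by (simp add: measure_map_pmf)
  then show thesis
    by (intro that[of "h -` S \<inter> set_pmf signed_geometric"]) (auto simp: measure_Int_set_pmf)
qed

lemma set_signed_geometric: "set_pmf signed_geometric \<subseteq> \<int>"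
  by (auto simp: signed_geometric_def)

lemma zero_isoperimetric_measure:
  obtains \<nu> :: "real measure" where "sets \<nu> = sets borel" "prob_space \<nu>" "even_measure \<nu>"
    "\<forall>p\<in>{0..1}. isoperimetric euclidean_metric \<nu> p = 0"
proof -
  let ?D = "set_pmf signed_geometric"
  define \<nu> where "\<nu> = distr (measure_pmf signed_geometric) borel (\<lambda>x. x)"
  have st: "sets \<nu> = sets borel" by (simp add: \<nu>_def)
  have P: "prob_space \<nu>" unfolding \<nu>_def by (rule measure_pmf.prob_space_distr) simp
  have M: "measure \<nu> A = measure_pmf.prob signed_geometric A" if "A \<in> sets borel" for A
    using that by (simp add: \<nu>_def measure_distr)
  have "distr \<nu> borel uminus = distr (measure_pmf signed_geometric) borel uminus"
    unfolding \<nu>_def by (subst distr_distr) (auto simp: comp_def)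
  also have "\<dots> = distr (distr (measure_pmf signed_geometric) (count_space UNIV) uminus) borel (\<lambda>x. x)"
    by (subst distr_distr) (auto simp: comp_def)
  also have "distr (measure_pmf signed_geometric) (count_space UNIV) uminus = measure_pmf signed_geometric"
    using signed_geometric_uminus by (simp add: map_pmf_rep_eq[symmetric])
  finally have ev: "even_measure \<nu>" by (simp add: even_measure_def \<nu>_def)
  have X: "metric_prob_space euclidean_metric \<nu>"
    by (rule metric_prob_space_euclidean[OF P st])
  have "isoperimetric euclidean_metric \<nu> p = 0" if p: "p \<in> {0..1}" for p
  proof -
    obtain A where A: "A \<subseteq> ?D" "measure_pmf.prob signed_geometric A = p"
      by (rule signed_geometric_subset[OF p])
    have "countable A" using A(1) countable_set_pmf by (rule countable_subset)
    then have Ab: "A \<in> sets borel" by (rule sets.countable[rotated]) auto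
    have eq: "measure \<nu> (enlargement euclidean_metric A r) = measure \<nu> A" if r: "0 < r" "r < 1" for r
    proof -
      let ?E = "enlargement euclidean_metric A r"
      have E: "?E \<in> sets borel"
        using openin_sets[OF X openin_enlargement[of A euclidean_metric r]] st by simp
      have "?E \<inter> ?D = A"
      proof
        show "?E \<inter> ?D \<subseteq> A"
        proof
          fix x assume x: "x \<in> ?E \<inter> ?D"
          then obtain y where y: "y \<in> A" "dist x y < r" by (auto simp: enlargement_euclidean)
          obtain i j where "x = of_int i" "y = of_int j"
            using x y A(1) set_signed_geometric by (meson Ints_cases IntD2 subsetD)
          moreover have "\<bar>x - y\<bar> < 1" using y r by (simp add: dist_real_def)
          ultimately have "x = y" by (simp flip: of_int_diff of_int_abs)
          then show "x \<in> A" using y by simp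
        qed
        show "A \<subseteq> ?E \<inter> ?D" using A(1) r by (auto simp: enlargement_euclidean intro!: bexI)
      qed
      then show ?thesis
        using measure_Int_set_pmf[of signed_geometric ?E] by (simp add: M[OF E] M[OF Ab])
    qed
    have "eventually (\<lambda>r. r \<in> {0<..<1}) (at_right (0::real))"
      by (intro eventually_at_right_real) simp
    then have "eventually (\<lambda>r. ennreal ((measure \<nu> (enlargement euclidean_metric A r) - measure \<nu> A) / r) \<le> 0) (at_right 0)"
      by eventually_elim (simp add: eq)
    then have "outer_boundary euclidean_metric \<nu> A \<le> 0"
      unfolding outer_boundary_def by (intro Liminf_le) simp_all
    moreover have "isoperimetric euclidean_metric \<nu> p \<le>
        min (outer_boundary euclidean_metric \<nu> A) (inner_boundary euclidean_metric \<nu> A)"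
      unfolding isoperimetric_def using A(2) Ab
      by (intro INF_lower) (simp add: M borel_sets_of_euclidean)
    ultimately show ?thesis by (simp add: min_def split: if_splits)
  qed
  then show thesis using that st P ev by blast
qed

section \<open>Extremal measures on the line\<close>

lemma point_mass_isoperimetric:
  fixes \<nu> :: "real measure"
  defines "\<nu> \<equiv> return borel 0"
  shows "sets \<nu> = sets borel" "prob_space \<nu>" "even_measure \<nu>"
    "\<And>p. p \<in> {0<..<1} \<Longrightarrow> isoperimetric euclidean_metric \<nu> p = \<top>"
proof -
  show "sets \<nu> = sets borel" "prob_space \<nu>" by (auto simp: \<nu>_def intro: prob_space_return)
  show "even_measure \<nu>" by (simp add: even_measure_def \<nu>_def distr_return)
  fix p :: real assume p: "p \<in> {0<..<1}"
  have "measure \<nu> A \<noteq> p" if "A \<in> borel_sets_of euclidean_metric" for A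
    using that p unfolding borel_sets_of_euclidean
    by (auto simp: \<nu>_def measure_return split: split_indicator)
  then have "{A \<in> borel_sets_of euclidean_metric. measure \<nu> A = p} = {}" by blast
  then show "isoperimetric euclidean_metric \<nu> p = \<top>"
    by (simp only: isoperimetric_def image_empty Inf_empty)
qed

lemma finite_profile_measure:
  assumes c: "\<forall>a\<in>{1/2..1}. 0 \<le> c a" and fin: "\<forall>p\<in>{0<..<1}. 0 < L_fun c p \<and> L_fun c p < \<top>"
  obtains \<nu> :: "real measure" and G where "sets \<nu> = sets borel" "prob_space \<nu>" "even_measure \<nu>"
    "\<forall>p\<in>{0..1}. isoperimetric euclidean_metric \<nu> p = L_fun c p"
    "\<forall>p\<in>{0<..<1}. measure \<nu> {..G p} = p \<and> outer_boundary euclidean_metric \<nu> {..G p} \<le> L_fun c p"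
proof -
  define l where "l = (\<lambda>p. enn2real (L_fun c p))"
  have L: "L_fun c p = ennreal (l p)" if "p \<in> {0..1}" for p
  proof (cases "p \<in> {0<..<1}")
    case False
    then have "p = 0 \<or> p = 1" using that by auto
    then show ?thesis by (auto simp: l_def L_fun_0_1)
  qed (use fin in \<open>simp add: l_def\<close>)
  have l0: "0 \<le> l p" for p by (simp add: l_def)
  interpret symmetric_profile l
  proof
    show "l 0 = 0" by (simp add: l_def L_fun_0_1)
    show "0 < l p" if "0 < p" "p < 1" for p
      using fin that by (simp add: l_def enn2real_positive_iff)
    show "l (1 - p) = l p" for p by (simp add: l_def L_fun_reflect)
    show "t * l p \<le> l (t * p)" if "0 \<le> p" "p \<le> 1" "0 \<le> t" "t \<le> 1" for p t
    proof -
      have "ennreal (t * l p) \<le> ennreal (l (t * p))"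
        using L_fun_scale[OF c that] L[of p] L[of "t * p"] that
        by (simp add: ennreal_mult l0 mult_le_one)
      then show ?thesis using l0 by (simp add: ennreal_le_iff)
    qed
  qed
  obtain G where G: "\<forall>p\<in>{0<..<1}. (G has_real_derivative 1 / l p) (at p)" "\<forall>p. G (1 - p) = - G p"
    using odd_quantile_exists by blast
  interpret odd_quantile l G
    by unfold_locales (use G in auto)
  have lower: "\<forall>p\<in>{0..1}. L_fun c p \<le> isoperimetric euclidean_metric law p"
    unfolding L_fun_le_isoperimetric_iff[OF law_metric_prob_space]
  proof (intro ballI)
    fix a A assume a: "a \<in> {1/2..1::real}" and A: "A \<in> borel_sets_of (euclidean_metric :: real metric)"
    have "ennreal (c a * model_profile (1/a) (measure law A)) \<le> L_fun c (measure law A)"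
      unfolding L_fun_model_profile using a by (intro SUP_upper)
    also have "\<dots> \<le> outer_boundary euclidean_metric law A"
      using l_le_outer_boundary[of A] A by (simp add: L borel_sets_of_euclidean)
    finally show "ennreal (c a * model_profile (1/a) (measure law A)) \<le> outer_boundary euclidean_metric law A" .
  qed
  have half: "measure law {..G p} = p \<and> outer_boundary euclidean_metric law {..G p} \<le> L_fun c p"
    if "p \<in> {0<..<1}" for p
    using measure_law_atMost[OF that] outer_boundary_half_line[OF that] L[of p] that by simp
  have "isoperimetric euclidean_metric law p = L_fun c p" if p: "p \<in> {0..1}" for p
  proof (cases "p \<in> {0<..<1}")
    case True
    have "isoperimetric euclidean_metric law p \<le>
        min (outer_boundary euclidean_metric law {..G p}) (inner_boundary euclidean_metric law {..G p})"
      unfolding isoperimetric_def using half[OF True]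
      by (intro INF_lower) (simp add: borel_sets_of_euclidean)
    also have "\<dots> \<le> L_fun c p" using half[OF True] by (simp add: min.coboundedI1)
    finally show ?thesis using lower p by (intro antisym) auto
  next
    case False
    then have "p = 0 \<or> p = 1" using p by auto
    then show ?thesis
      using isoperimetric_0_1[OF law_metric_prob_space] L_fun_0_1 by auto
  qed
  then show thesis
    using half by (intro that[of law G]) (auto intro: even_law law.prob_space_axioms)
qed

text \<open>A coordinate half-space is the cylinder over a half-line.\<close>

lemma halfspaces_solve_of_half_lines:
  assumes P: "prob_space \<nu>" and st: "sets \<nu> = sets borel" and n: "n \<ge> 1"
    and half: "\<forall>p\<in>{0<..<1}. measure \<nu> {..G p} = p \<and>
      outer_boundary euclidean_metric \<nu> {..G p} \<le>
        isoperimetric (funspace {..<n} euclidean_metric) (Pi\<^sub>M {..<n} (\<lambda>_. \<nu>)) p"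
  shows "halfspaces_solve n \<nu>"
  unfolding halfspaces_solve_def Let_def
proof (intro ballI exI conjI)
  fix p :: real assume p: "p \<in> {0<..<1}"
  let ?Y = "funspace {..<n} euclidean_metric" and ?P = "Pi\<^sub>M {..<n} (\<lambda>_. \<nu>)"
  let ?H = "coord_halfspace n (G p)"
  have X: "metric_prob_space euclidean_metric \<nu>" by (rule metric_prob_space_euclidean[OF P st])
  have H: "?H = {x \<in> \<Pi>\<^sub>E i\<in>{..<n}. mspace euclidean_metric. x 0 \<in> {..G p}}"
    by (simp add: coord_halfspace_def)
  have b: "{..G p} \<in> borel_sets_of euclidean_metric" by (simp add: borel_sets_of_euclidean)
  have i: "0 \<in> {..<n}" using n by simp
  note cyl = outer_boundary_cylinder[OF X b finite_lessThan i, folded H]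
  show m: "measure ?P ?H = p" using cyl(2) half p by simp
  have "isoperimetric ?Y ?P p \<le> min (outer_boundary ?Y ?P ?H) (inner_boundary ?Y ?P ?H)"
    unfolding isoperimetric_def using cyl(1) m by (intro INF_lower) simp
  moreover have "min (outer_boundary ?Y ?P ?H) (inner_boundary ?Y ?P ?H) \<le> isoperimetric ?Y ?P p"
    using half p cyl(3) by (simp add: min.coboundedI1)
  ultimately show "min (outer_boundary ?Y ?P ?H) (inner_boundary ?Y ?P ?H) = isoperimetric ?Y ?P p"
    by (rule antisym[rotated])
qed

lemma extremal_line_measure_exists:
  fixes c :: "real \<Rightarrow> real"
  assumes "\<forall>a\<in>{1/2..1}. 0 \<le> c a"
  shows "\<exists>\<nu> :: real measure.
    sets \<nu> = sets borel \<and> prob_space \<nu> \<and> even_measure \<nu> \<and>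
    (\<forall>p\<in>{0..1}. isoperimetric euclidean_metric \<nu> p = L_fun c p \<and>
                profile_inf euclidean_metric \<nu> p = L_fun c p) \<and>
    ((\<forall>p\<in>{0<..<1}. 0 < L_fun c p \<and> L_fun c p < \<infinity>) \<longrightarrow>
       (\<forall>n\<ge>1. halfspaces_solve n \<nu>))"
proof -
  have suffices: ?thesis if \<nu>: "sets \<nu> = sets borel" "prob_space \<nu>" "even_measure \<nu>"
    "\<forall>p\<in>{0..1}. isoperimetric euclidean_metric \<nu> p = L_fun c p"
    "(\<forall>p\<in>{0<..<1}. 0 < L_fun c p \<and> L_fun c p < \<infinity>) \<longrightarrow> (\<forall>n\<ge>1. halfspaces_solve n \<nu>)"
    for \<nu> :: "real measure"
    using \<nu> profile_inf_eq_L_fun(2)[OF metric_prob_space_euclidean[OF \<nu>(2,1)] assms \<nu>(4), of 1]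
    by (intro exI[of _ \<nu>]) auto
  from assms show ?thesis
  proof (cases rule: L_fun_cases)
    case zero
    obtain \<nu> :: "real measure" where \<nu>: "sets \<nu> = sets borel" "prob_space \<nu>" "even_measure \<nu>"
      "\<forall>p\<in>{0..1}. isoperimetric euclidean_metric \<nu> p = 0" by (rule zero_isoperimetric_measure)
    have "\<not> (\<forall>p\<in>{0<..<1}. 0 < L_fun c p \<and> L_fun c p < \<infinity>)"
    proof
      assume "\<forall>p\<in>{0<..<1}. 0 < L_fun c p \<and> L_fun c p < \<infinity>"
      from bspec[OF this, of "1/2"] show False using zero by simp
    qed
    then show ?thesis using suffices[OF \<nu>(1-3)] \<nu>(4) zero by simp
  next
    case top
    let ?\<nu> = "return borel (0::real)"
    note \<nu> = point_mass_isoperimetric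
    have "isoperimetric euclidean_metric ?\<nu> p = L_fun c p" if "p \<in> {0..1}" for p
    proof (cases "p \<in> {0<..<1}")
      case False
      then have "p = 0 \<or> p = 1" using that by auto
      then show ?thesis
        using isoperimetric_0_1[OF metric_prob_space_euclidean[OF \<nu>(2,1)]] L_fun_0_1 by auto
    qed (use top \<nu>(4) in auto)
    moreover have "\<not> (\<forall>p\<in>{0<..<1}. 0 < L_fun c p \<and> L_fun c p < \<infinity>)"
    proof
      assume "\<forall>p\<in>{0<..<1}. 0 < L_fun c p \<and> L_fun c p < \<infinity>"
      from bspec[OF this, of "1/2"] show False using top by simp
    qed
    ultimately show ?thesis by (intro suffices[OF \<nu>(1-3)]) blast+
  next
    case finite
    obtain \<nu> :: "real measure" and G where \<nu>: "sets \<nu> = sets borel" "prob_space \<nu>" "even_measure \<nu>"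
      "\<forall>p\<in>{0..1}. isoperimetric euclidean_metric \<nu> p = L_fun c p"
      "\<forall>p\<in>{0<..<1}. measure \<nu> {..G p} = p \<and> outer_boundary euclidean_metric \<nu> {..G p} \<le> L_fun c p"
      by (rule finite_profile_measure[OF assms finite])
    have "halfspaces_solve n \<nu>" if n: "n \<ge> 1" for n
    proof (rule halfspaces_solve_of_half_lines[OF \<nu>(2,1) n])
      show "\<forall>p\<in>{0<..<1}. measure \<nu> {..G p} = p \<and> outer_boundary euclidean_metric \<nu> {..G p} \<le>
        isoperimetric (funspace {..<n} euclidean_metric) (Pi\<^sub>M {..<n} (\<lambda>_. \<nu>)) p"
        using \<nu>(5) profile_inf_eq_L_fun(1)[OF metric_prob_space_euclidean[OF \<nu>(2,1)] assms \<nu>(4) n] by simp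
    qed
    then show ?thesis using suffices[OF \<nu>(1-4)] by simp
  qed
qed

theorem theorem3:
  fixes c :: "real \<Rightarrow> real"
  assumes "\<forall>a\<in>{1/2..1}. 0 \<le> c a"
  shows "(\<forall>(X :: 'a metric) \<mu>.
            metric_prob_space X \<mu> \<and> hypothesis_H X \<mu> \<and>
            (\<forall>p\<in>{0..1}. L_fun c p \<le> isoperimetric X \<mu> p) \<longrightarrow>
            (\<forall>p\<in>{0..1}. L_fun c p \<le> profile_inf X \<mu> p)) \<and>
         (\<exists>\<nu> :: real measure.
            sets \<nu> = sets borel \<and> prob_space \<nu> \<and> even_measure \<nu> \<and>
            (\<forall>p\<in>{0..1}. isoperimetric euclidean_metric \<nu> p = L_fun c p \<and>
                        profile_inf euclidean_metric \<nu> p = L_fun c p) \<and>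
            ((\<forall>p\<in>{0<..<1}. 0 < L_fun c p \<and> L_fun c p < \<infinity>) \<longrightarrow>
               (\<forall>n\<ge>1. halfspaces_solve n \<nu>)))"
proof (intro conjI allI impI)
  fix X :: "'a metric" and \<mu>
  assume *: "metric_prob_space X \<mu> \<and> hypothesis_H X \<mu> \<and>
    (\<forall>p\<in>{0..1}. L_fun c p \<le> isoperimetric X \<mu> p)"
  show "\<forall>p\<in>{0..1}. L_fun c p \<le> profile_inf X \<mu> p"
    unfolding profile_inf_def
  proof (intro ballI INF_greatest)
    fix p n assume p: "p \<in> {0..1::real}" and n: "n \<in> {1::nat..}"
    have "0 \<in> {..<n}" using n by simp
    then have "{..<n} \<noteq> {}" by blast
    then show "L_fun c p \<le> isoperimetric (funspace {..<n} X) (Pi\<^sub>M {..<n} (\<lambda>_. \<mu>)) p"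
      using L_fun_le_isoperimetric_power[of X \<mu> c "{..<n}"] * assms p by simp
  qed
next
  show "\<exists>\<nu> :: real measure.
            sets \<nu> = sets borel \<and> prob_space \<nu> \<and> even_measure \<nu> \<and>
            (\<forall>p\<in>{0..1}. isoperimetric euclidean_metric \<nu> p = L_fun c p \<and>
                        profile_inf euclidean_metric \<nu> p = L_fun c p) \<and>
            ((\<forall>p\<in>{0<..<1}. 0 < L_fun c p \<and> L_fun c p < \<infinity>) \<longrightarrow>
               (\<forall>n\<ge>1. halfspaces_solve n \<nu>))"
    using assms by (rule extremal_line_measure_exists)
qed

end
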